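(* There exist universal constants $c,c'\in(0,\infty)$ such that for every integer $n>15$, every $q\in[2,\infty)$ and every $K\in[1,\infty)$, any $K$-tensor-symmetric norm $\|\cdot\|$ on $\mathbb{R}^n\otimes\mathbb{R}^n\otimes\mathbb{R}^n$ satisfies $$C_{\|\cdot\|}^{(q)}\ge c'\,\frac{\left\|\sum_{i=1}^{n}e_i\otimes e_i\otimes e_i\right\|}{\left\|\sum_{i=1}^{n}\sum_{j=1}^{n}\sum_{k=1}^{n}e_i\otimes e_j\otimes e_k\right\|}\cdot\frac{\exp\left(\frac{c}{q}\cdot\frac{(\log\log n)^2}{\log\log\log n}\right)}{K^2\log n}.$$
   Context: $\log$ is the natural logarithm; $e_1,\dots,e_n$ is the standard basis of $\mathbb{R}^n$; $S_n$ is the group of permutations of $\{1,\dots,n\}$. Tensor-symmetric norm: for $K\in[1,\infty)$, a norm $\|\cdot\|$ on $\mathbb{R}^n\otimes\mathbb{R}^n\otimes\mathbb{R}^n$ is $K$-tensor-symmetric if for all $\pi,\sigma,\tau\in S_n$, all $\varepsilon,\delta,\eta\in\{-1,1\}^n$ and all scalars $\{a_{i,j,k}\}_{i,j,k=1}^n\subseteq\mathbb{R}$, $$\left\|\sum_{i,j,k=1}^n\varepsilon_i\delta_j\eta_k\,a_{\pi(i),\sigma(j),\tau(k)}\,e_i\otimes e_j\otimes e_k\right\|\le K\left\|\sum_{i,j,k=1}^n a_{i,j,k}\,e_i\otimes e_j\otimes e_k\right\|.$$ Cotype constant: for a norm $\|\cdot\|$ on a finite-dimensional real vector space $V$ and $q\in[2,\infty)$,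 $C_{\|\cdot\|}^{(q)}$ is the infimum of those $C\in(0,\infty)$ such that for every $N\in\mathbb{N}$ and all $x_1,\dots,x_N\in V$, $\left(\sum_{i=1}^N\|x_i\|^q\right)^{1/q}\le C\left(\mathbb{E}\left[\left\|\sum_{i=1}^N\varepsilon_ix_i\right\|^2\right]\right)^{1/2}$, with $\varepsilon$ uniform on $\{-1,1\}^N$. *)

theory Defs
  imports "HOL-Probability.Probability" "HOL-Analysis.Finite_Function_Topology"
begin

text \<open>Vectors are finitely supported real functions on the naturals (coordinates \<open>1..n\<close>), so that
  $\mathbb{R}^n$ is available for all \<open>n\<close> within a single type. The norms under
  consideration are functions \<open>nrm\<close> that only matter on a given subspace; they are unrelated to
  the type class \<open>norm\<close> of finitely supported functions, of which only the vector space
  structure is used.\<close>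

definition norm_on :: "'a::real_vector set \<Rightarrow> ('a \<Rightarrow> real) \<Rightarrow> bool" where
  "norm_on V nrm \<longleftrightarrow>
     (\<forall>x\<in>V. nrm x \<ge> 0 \<and> (nrm x = 0 \<longleftrightarrow> x = 0)) \<and>
     (\<forall>x\<in>V. \<forall>r. nrm (r *\<^sub>R x) = \<bar>r\<bar> * nrm x) \<and>
     (\<forall>x\<in>V. \<forall>y\<in>V. nrm (x + y) \<le> nrm x + nrm y)"

definition stdbasis :: "nat \<Rightarrow> (nat \<Rightarrow>\<^sub>0 real)" where
  "stdbasis i = Poly_Mapping.single i 1"

definition Rn :: "nat \<Rightarrow> (nat \<Rightarrow>\<^sub>0 real) set" where
  "Rn n = span (stdbasis ` {1..n})"

lift_definition tensor3 ::
  "(nat \<Rightarrow>\<^sub>0 real) \<Rightarrow> (nat \<Rightarrow>\<^sub>0 real) \<Rightarrow> (nat \<Rightarrow>\<^sub>0 real) \<Rightarrow> (nat \<times> nat \<times> nat \<Rightarrow>\<^sub>0 real)"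
  is "\<lambda>x y z (i, j, k). x i * y j * z k"
proof -
  fix x y z :: "nat \<Rightarrow> real"
  assume fin: "finite {i. x i \<noteq> 0}" "finite {j. y j \<noteq> 0}" "finite {k. z k \<noteq> 0}"
  have "{p. (case p of (i, j, k) \<Rightarrow> x i * y j * z k) \<noteq> 0}
          \<subseteq> {i. x i \<noteq> 0} \<times> {j. y j \<noteq> 0} \<times> {k. z k \<noteq> 0}"
    by auto
  then show "finite {p. (case p of (i, j, k) \<Rightarrow> x i * y j * z k) \<noteq> 0}"
    using fin by (meson finite_SigmaI finite_subset)
qed

definition tensor_space :: "nat \<Rightarrow> (nat \<times> nat \<times> nat \<Rightarrow>\<^sub>0 real) set" where
  "tensor_space n = span {tensor3 x y z | x y z. x \<in> Rn n \<and> y \<in> Rn n \<and> z \<in> Rn n}"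

definition tensor_symmetric ::
  "nat \<Rightarrow> real \<Rightarrow> ((nat \<times> nat \<times> nat \<Rightarrow>\<^sub>0 real) \<Rightarrow> real) \<Rightarrow> bool" where
  "tensor_symmetric n K nrm \<longleftrightarrow>
     (\<forall>\<pi> \<sigma> \<tau> (\<epsilon> :: nat \<Rightarrow> real) (\<delta> :: nat \<Rightarrow> real) (\<eta> :: nat \<Rightarrow> real)
        (a :: nat \<Rightarrow> nat \<Rightarrow> nat \<Rightarrow> real).
        \<pi> permutes {1..n} \<longrightarrow> \<sigma> permutes {1..n} \<longrightarrow> \<tau> permutes {1..n} \<longrightarrow>
        \<epsilon> \<in> {1..n} \<rightarrow> {-1, 1} \<longrightarrow> \<delta> \<in> {1..n} \<rightarrow> {-1, 1} \<longrightarrow> \<eta> \<in> {1..n} \<rightarrow> {-1, 1} \<longrightarrow>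
        nrm (\<Sum>i=1..n. \<Sum>j=1..n. \<Sum>k=1..n.
               (\<epsilon> i * \<delta> j * \<eta> k * a (\<pi> i) (\<sigma> j) (\<tau> k)) *\<^sub>R
                 tensor3 (stdbasis i) (stdbasis j) (stdbasis k))
          \<le> K * nrm (\<Sum>i=1..n. \<Sum>j=1..n. \<Sum>k=1..n.
               a i j k *\<^sub>R tensor3 (stdbasis i) (stdbasis j) (stdbasis k)))"

text \<open>The infimum is taken in the extended reals, so that it is \<open>\<infinity>\<close> if no constant \<open>C\<close>
  exists (which does not happen on finite-dimensional spaces).\<close>

definition cotype_const :: "'a::real_vector set \<Rightarrow> ('a \<Rightarrow> real) \<Rightarrow> real \<Rightarrow> ereal" where
  "cotype_const V nrm q =
     Inf (ereal ` {C. 0 < C \<and>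
       (\<forall>N (x :: nat \<Rightarrow> 'a). x \<in> {1..N} \<rightarrow> V \<longrightarrow>
          (\<Sum>i=1..N. nrm (x i) powr q) powr (1 / q)
            \<le> C * sqrt (measure_pmf.expectation (pmf_of_set ({1..N} \<rightarrow>\<^sub>E {-1, 1::real}))
                 (\<lambda>\<epsilon>. (nrm (\<Sum>i=1..N. \<epsilon> i *\<^sub>R x i))\<^sup>2)))})"

end

theory Submission
  imports Defs "HOL-Number_Theory.Cong" "HOL-Combinatorics.Permutations"
begin

text \<open>
  The bound comes from three-query locally decodable codes of subexponential length. Such a code
  assigns to each coordinate \<open>a\<close> of the tensor space a character \<open>f\<^sub>a\<close> of \<open>{-1, 1}\<^sup>G\<close>, such that for
  every \<open>g \<in> G\<close> a positive proportion of the coordinates can be matched into triples with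
  \<open>f\<^sub>a f\<^sub>b f\<^sub>c = x\<^sub>g\<close>. Let \<open>W\<^sub>g\<close> be the sum of all \<open>e\<^sub>a \<otimes> e\<^sub>b \<otimes> e\<^sub>c\<close> with \<open>f\<^sub>a f\<^sub>b f\<^sub>c = x\<^sub>g\<close>. Averaging over
  signs and permutations shows that the norm of \<open>W\<^sub>g\<close> is at least of the order of the norm of the
  diagonal tensor, up to \<open>K\<close>. On the other hand \<open>\<Sum>g. x\<^sub>g W\<^sub>g\<close> is the part of degree one of the function
  \<open>x \<mapsto> f(x) \<otimes> f(x) \<otimes> f(x)\<close>, whose values have norm at most \<open>K\<close> times that of the all-ones tensor;
  as in Pisier's estimate of the Rademacher projection, passing to the part of degree one costs only
  a power of \<open>log n\<close>. The cotype inequality for the \<open>W\<^sub>g\<close> therefore forces the constant to be at least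
  \<open>(card G) powr (1 / q)\<close> times the ratio of the norms, up to powers of \<open>K log n\<close>.
  Such powers are harmless: if the exponential in the claim is at most \<open>K log n\<close>, then the claim is
  trivial, since the cotype constant is at least 1 and the diagonal tensor is at most \<open>K\<close> times the
  all-ones tensor in norm.

  The code is Efremenko's: the matching vectors modulo 511 = 7 * 73 are those of Grolmusz, and the
  decoding polynomial has three terms over the field with 512 elements.
\<close>

section \<open>A three-term recurrence of period 511\<close>

text \<open>An element of the field with 512 elements, in the basis dual to \<open>1, \<gamma>, \<dots>, \<gamma>\<^sup>8\<close> where
  \<open>\<gamma>\<^sup>9 = \<gamma>\<^sup>4 + 1\<close>; the shift is multiplication by \<open>\<gamma>\<close>, and \<open>lfsr n\<close> is a nonzero linear functional of
  \<open>\<gamma>\<^sup>n\<close>.\<close>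

type_synonym gf = "bool \<times> bool \<times> bool \<times> bool \<times> bool \<times> bool \<times> bool \<times> bool \<times> bool"

fun gf_shift :: "gf \<Rightarrow> gf" where
  "gf_shift (a, b, c, d, e, f, g, h, i) = (b, c, d, e, f, g, h, i, e \<noteq> a)"

fun gf_add :: "gf \<Rightarrow> gf \<Rightarrow> gf" where
  "gf_add (a, b, c, d, e, f, g, h, i) (a', b', c', d', e', f', g', h', i') =
     (a \<noteq> a', b \<noteq> b', c \<noteq> c', d \<noteq> d', e \<noteq> e', f \<noteq> f', g \<noteq> g', h \<noteq> h', i \<noteq> i')"

definition gf_one :: gf where
  "gf_one = (True, False, False, False, False, False, False, False, False)"

definition gf_zero :: gf where
  "gf_zero = (False, False, False, False, False, False, False, False, False)"

definition lfsr :: "nat \<Rightarrow> bool" where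
  "lfsr n = fst ((gf_shift ^^ n) gf_one)"

lemma gf_shift_add: "gf_shift (gf_add x y) = gf_add (gf_shift x) (gf_shift y)"
  by (cases x rule: gf_shift.cases; cases y rule: gf_shift.cases) auto

lemma gf_shift_pow_add: "(gf_shift ^^ n) (gf_add x y) = gf_add ((gf_shift ^^ n) x) ((gf_shift ^^ n) y)"
  by (induction n) (auto simp: gf_shift_add)

lemma gf_shift_pow_zero: "(gf_shift ^^ n) gf_zero = gf_zero"
  by (induction n) (auto simp: gf_zero_def)

lemma fst_gf_add: "fst (gf_add x y) \<longleftrightarrow> fst x \<noteq> fst y"
  by (cases x rule: gf_shift.cases; cases y rule: gf_shift.cases) auto

lemma gf_shift_period: "(gf_shift ^^ 511) gf_one = gf_one"
  by code_simp

lemma lfsr_period: "lfsr (n + 511) = lfsr n"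
  by (simp only: lfsr_def funpow_add o_apply gf_shift_period)

lemma lfsr_mod: "lfsr (n mod 511) = lfsr n"
proof -
  have "lfsr (k + 511 * d) = lfsr k" for k d
  proof (induction d)
    case (Suc d)
    have "lfsr (k + 511 * Suc d) = lfsr (k + 511 * d + 511)" by (simp add: algebra_simps)
    also have "\<dots> = lfsr k" unfolding lfsr_period by (rule Suc)
    finally show ?case .
  qed simp
  from this[of "n mod 511" "n div 511"] show ?thesis by simp
qed

lemma lfsr_relation:
  assumes "gf_add ((gf_shift ^^ a) gf_one) (gf_add ((gf_shift ^^ b) gf_one) ((gf_shift ^^ c) gf_one)) = x"
  shows "(lfsr (e + a) \<noteq> (lfsr (e + b) \<noteq> lfsr (e + c))) = fst ((gf_shift ^^ e) x)"
  unfolding assms[symmetric] gf_shift_pow_add fst_gf_add lfsr_def funpow_add o_apply ..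

text \<open>In the field with 512 elements, the polynomial
  \<open>\<gamma>^341 + \<gamma>^192 * x^3 + \<gamma>^489 * x^144\<close> vanishes at \<open>\<gamma>\<^sup>s\<close> for \<open>s = 1, 147, 365\<close> and takes the value 1 at 1;
  the constants were found by computer search.\<close>

lemma lfsr_decode:
  assumes "s mod 511 \<in> {0, 1, 147, 365}"
  shows "(lfsr (e + 341) \<noteq> (lfsr (e + (192 + 3 * s)) \<noteq> lfsr (e + (489 + 144 * s))))
           = (s mod 511 = 0 \<and> lfsr e)"
proof -
  define r where "r = s mod 511"
  have red: "lfsr (e + (c + b * s)) = lfsr (e + (c + b * r) mod 511)" for c b
  proof -
    have "lfsr (e + (c + b * s)) = lfsr ((e + (c + b * s)) mod 511)" by (simp only: lfsr_mod)
    also have "(e + (c + b * s)) mod 511 = (e + (c + b * r) mod 511) mod 511"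
      unfolding r_def by (metis mod_add_right_eq mod_mult_right_eq)
    finally show ?thesis by (simp only: lfsr_mod)
  qed
  have 0: "(lfsr (e + 341) \<noteq> (lfsr (e + 192) \<noteq> lfsr (e + 489))) = lfsr e"
    by (subst lfsr_relation[where x = gf_one], code_simp) (simp add: lfsr_def)
  have zero: "fst ((gf_shift ^^ e) gf_zero) = False"
    by (simp add: gf_shift_pow_zero) (simp add: gf_zero_def)
  have 1: "(lfsr (e + 341) \<noteq> (lfsr (e + 195) \<noteq> lfsr (e + 122))) = False"
    by (subst lfsr_relation[where x = gf_zero], code_simp) (rule zero)
  have 2: "(lfsr (e + 341) \<noteq> (lfsr (e + 265) \<noteq> lfsr (e + 416))) = False"
    by (subst lfsr_relation[where x = gf_zero], code_simp) (rule zero)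
  have "r \<in> {0, 1, 147, 365}" using assms by (simp only: r_def)
  then consider "r = 0" | "r = 1" | "r = 147" | "r = 365" by auto
  then show ?thesis
    unfolding red r_def[symmetric] using 0 1 2 by cases auto
qed

lemma lfsr_nonzero_window: "\<exists>d<9. lfsr (n + d)"
proof (rule ccontr)
  assume *: "\<not> (\<exists>d<9. lfsr (n + d))"
  let ?x = "(gf_shift ^^ n) gf_one"
  have "fst ((gf_shift ^^ d) ?x) = False" if "d < 9" for d
    using * that by (auto simp: lfsr_def funpow_add add.commute)
  from this[of 0] this[of 1] this[of 2] this[of 3] this[of 4] this[of 5] this[of 6] this[of 7] this[of 8]
  have "?x = gf_zero"
    by (cases ?x rule: gf_shift.cases) (auto simp: gf_zero_def numeral_eq_Suc)
  then have "(gf_shift ^^ (510 * n)) ?x = gf_zero" by (simp add: gf_shift_pow_zero)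
  then have "fst ((gf_shift ^^ (510 * n + n)) gf_one) = False"
    unfolding funpow_add o_apply by (simp add: gf_zero_def)
  then have "lfsr (511 * n) = False" by (simp add: lfsr_def)
  moreover have "lfsr (511 * n) = lfsr 0" by (metis lfsr_mod mod_mult_self1_is_0)
  ultimately show False by (simp add: lfsr_def gf_one_def)
qed

section \<open>Matching vectors modulo 511 and the code\<close>

lemma prime_dvd_prime_power_choose:
  fixes p :: nat
  assumes "prime p" "0 < j" "j < p ^ e"
  shows "p dvd (p ^ e choose j)"
proof (rule ccontr)
  assume "\<not> p dvd (p ^ e choose j)"
  then have "coprime (p ^ e) (p ^ e choose j)"
    using assms(1) by (simp add: prime_imp_coprime)
  moreover have "p ^ e dvd j * (p ^ e choose j)"
    using times_binomial_minus1_eq[OF assms(2), of "p ^ e"] by simp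
  ultimately have "p ^ e dvd j"
    by (simp add: coprime_dvd_mult_left_iff)
  then show False using assms by (auto dest: dvd_imp_le)
qed

lemma choose_add_prime_power_cong:
  fixes p :: nat
  assumes "prime p" "s < p ^ e"
  shows "[(p ^ e + l) choose s = l choose s] (mod p)"
proof -
  have "((p ^ e + l) choose s) = (\<Sum>k\<le>s. (p ^ e choose k) * (l choose (s - k)))"
    by (rule vandermonde[symmetric])
  also have "\<dots> = (l choose s) + (\<Sum>k\<in>{..s} - {0}. (p ^ e choose k) * (l choose (s - k)))"
    by (subst sum.remove[of _ 0]) auto
  also have "[\<dots> = (l choose s) + 0] (mod p)"
    unfolding cong_0_iff using assms
    by (intro cong_add cong_refl) (auto simp: cong_0_iff intro!: dvd_sum dvd_mult2 prime_dvd_prime_power_choose)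
  finally show ?thesis by simp
qed

lemma choose_prime_power_minus_1_cong:
  fixes p :: nat
  assumes "prime p"
  shows "[l choose (p ^ e - 1) = of_bool (p ^ e dvd Suc l)] (mod p)"
proof (induction l rule: less_induct)
  case (less l)
  have pos: "p ^ e > 0" using assms by (simp add: prime_gt_0_nat)
  show ?case
  proof (cases "l < p ^ e")
    case True
    show ?thesis
    proof (cases "l = p ^ e - 1")
      case True
      then show ?thesis using pos by simp
    next
      case False
      with True have "Suc l < p ^ e" by simp
      then have "\<not> p ^ e dvd Suc l" by (auto dest: dvd_imp_le)
      moreover have "l choose (p ^ e - 1) = 0" using True False by (intro binomial_eq_0) simp
      ultimately show ?thesis by (simp only: of_bool_eq cong_refl)
    qed
  next
    case False
    define l' where "l' = l - p ^ e"
    have l: "l = p ^ e + l'" using False by (simp add: l'_def)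
    have "[l choose (p ^ e - 1) = l' choose (p ^ e - 1)] (mod p)"
      unfolding l using assms pos by (intro choose_add_prime_power_cong) auto
    also have "[l' choose (p ^ e - 1) = of_bool (p ^ e dvd Suc l')] (mod p)"
      using less.IH[of l'] l pos by simp
    also have "p ^ e dvd Suc l' \<longleftrightarrow> p ^ e dvd Suc l"
      unfolding l using dvd_add_right_iff[of "p ^ e" "p ^ e" "Suc l'"] by simp
    finally show ?thesis .
  qed
qed

text \<open>The constants come from the Chinese remainder theorem: \<open>-146\<close> is 1 modulo 7 and 0 modulo 73,
  \<open>-364\<close> is 0 modulo 7 and 1 modulo 73.\<close>

lemma mod_511_representation:
  fixes a b l :: nat
  defines "s \<equiv> 1 + 146 * (l choose (7 ^ a - 1)) + 364 * (l choose (73 ^ b - 1))"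
  shows "s mod 511 \<in> {0, 1, 147, 365}"
    and "l < 7 ^ a * 73 ^ b \<Longrightarrow> s mod 511 = 0 \<longleftrightarrow> Suc l = 7 ^ a * 73 ^ b"
proof -
  define x y where "x = (l choose (7 ^ a - 1))" and "y = (l choose (73 ^ b - 1))"
  have "prime (7::nat)" by simp
  from choose_prime_power_minus_1_cong[OF this]
  have x: "x mod 7 = of_bool (7 ^ a dvd Suc l)" by (simp add: cong_def x_def)
  have "prime (73::nat)" by simp
  from choose_prime_power_minus_1_cong[OF this]
  have y: "y mod 73 = of_bool (73 ^ b dvd Suc l)" by (simp add: cong_def y_def)
  have lin: "1 + 146 * (m + 7 * u) + 364 * (n + 73 * v) = (1 + 146 * m + 364 * n) + 511 * (2 * u + 52 * v)"
    for m u n v :: nat by simp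
  have "s = 1 + 146 * (x mod 7 + 7 * (x div 7)) + 364 * (y mod 73 + 73 * (y div 73))"
    by (simp only: s_def x_def y_def mod_mult_div_eq)
  also have "\<dots> = (1 + 146 * (x mod 7) + 364 * (y mod 73)) + 511 * (2 * (x div 7) + 52 * (y div 73))"
    by (rule lin)
  finally have s: "s mod 511 = (1 + 146 * (x mod 7) + 364 * (y mod 73)) mod 511"
    by (simp only: mod_mult_self2)
  show "s mod 511 \<in> {0, 1, 147, 365}" unfolding s x y by auto
  assume l: "l < 7 ^ a * 73 ^ b"
  have "coprime (7 ^ a) (73 ^ b :: nat)"
    by (simp add: primes_coprime)
  then have "7 ^ a dvd Suc l \<and> 73 ^ b dvd Suc l \<longleftrightarrow> 7 ^ a * 73 ^ b dvd Suc l"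
    using divides_mult by (auto dest: dvd_mult_left dvd_mult_right)
  also have "\<dots> \<longleftrightarrow> Suc l = 7 ^ a * 73 ^ b"
    using l by (auto dest!: dvd_imp_le)
  finally show "s mod 511 = 0 \<longleftrightarrow> Suc l = 7 ^ a * 73 ^ b"
    unfolding s x y by (auto simp: of_bool_def)
qed

definition matching_code :: "'g set \<Rightarrow> 'y set \<Rightarrow> ('y \<Rightarrow> 'g \<Rightarrow> bool) \<Rightarrow> bool" where
  "matching_code G Y F \<longleftrightarrow> (\<forall>g\<in>G. \<exists>M s\<^sub>1 s\<^sub>2 s\<^sub>3.
     M \<subseteq> Y \<and> card Y \<le> 9 * card M \<and>
     s\<^sub>1 \<in> M \<rightarrow> Y \<and> inj_on s\<^sub>1 M \<and> s\<^sub>2 \<in> M \<rightarrow> Y \<and> inj_on s\<^sub>2 M \<and> s\<^sub>3 \<in> M \<rightarrow> Y \<and> inj_on s\<^sub>3 M \<and>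
     (\<forall>y\<in>M. \<forall>h\<in>G. (F (s\<^sub>1 y) h \<noteq> (F (s\<^sub>2 y) h \<noteq> F (s\<^sub>3 y) h)) \<longleftrightarrow> h = g))"

lemma matching_codeE:
  assumes "matching_code G Y F" "g \<in> G"
  obtains M s\<^sub>1 s\<^sub>2 s\<^sub>3 where "M \<subseteq> Y" "card Y \<le> 9 * card M"
    "s\<^sub>1 \<in> M \<rightarrow> Y" "inj_on s\<^sub>1 M" "s\<^sub>2 \<in> M \<rightarrow> Y" "inj_on s\<^sub>2 M" "s\<^sub>3 \<in> M \<rightarrow> Y" "inj_on s\<^sub>3 M"
    "\<forall>y\<in>M. \<forall>h\<in>G. (F (s\<^sub>1 y) h \<noteq> (F (s\<^sub>2 y) h \<noteq> F (s\<^sub>3 y) h)) \<longleftrightarrow> h = g"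
proof -
  from bspec[OF assms(1)[unfolded matching_code_def] assms(2)] show thesis
    by (elim exE conjE) (rule that)
qed

definition translate :: "'h set \<Rightarrow> ('h \<Rightarrow> nat) \<Rightarrow> ('h \<Rightarrow> nat) \<Rightarrow> 'h \<Rightarrow> nat" where
  "translate H v x = (\<lambda>T\<in>H. (x T + v T) mod 511)"

lemma translate_closed: "translate H v x \<in> H \<rightarrow>\<^sub>E {..<511}"
  by (auto simp: translate_def)

lemma inj_on_translate: "inj_on (translate H v) (H \<rightarrow>\<^sub>E {..<511})"
proof (rule inj_onI)
  fix x y assume xy: "x \<in> H \<rightarrow>\<^sub>E {..<511}" "y \<in> H \<rightarrow>\<^sub>E {..<511}" "translate H v x = translate H v y"
  show "x = y"
  proof (rule PiE_ext[OF xy(1,2)])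
    fix T assume T: "T \<in> H"
    from xy(3) have "translate H v x T = translate H v y T" by simp
    then have "[x T + v T = y T + v T] (mod 511)" using T by (simp add: translate_def cong_def)
    then have "[x T = y T] (mod 511)" by (simp only: cong_add_rcancel_nat)
    moreover have "x T < 511" "y T < 511" using xy(1,2) T by auto
    ultimately show "x T = y T" by (simp add: cong_def)
  qed
qed

lemma sum_translate_mod:
  assumes "A \<subseteq> H"
  shows "lfsr (\<Sum>T\<in>A. translate H v x T) = lfsr ((\<Sum>T\<in>A. x T) + (\<Sum>T\<in>A. v T))"
proof -
  have "(\<Sum>T\<in>A. translate H v x T) = (\<Sum>T\<in>A. (x T + v T) mod 511)"
    using assms by (intro sum.cong) (auto simp: translate_def)
  also have "\<dots> mod 511 = ((\<Sum>T\<in>A. x T) + (\<Sum>T\<in>A. v T)) mod 511"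
    by (simp add: mod_sum_eq sum.distrib)
  finally show ?thesis by (metis lfsr_mod)
qed

text \<open>The coordinate \<open>{}\<close> of a position carries an additive constant. The translation by \<open>v g c d\<close> in the
  proof adds \<open>c + d * s\<close> to the exponent at \<open>h\<close>, where \<open>s\<close>, the inner product of the matching vectors
  of \<open>g\<close> and \<open>h\<close>, is 0 modulo 511 exactly if \<open>h = g\<close>.\<close>

lemma matching_code_subsets:
  fixes U :: "'u set" and a b :: nat
  assumes U: "finite U"
  defines "w \<equiv> 7 ^ a * 73 ^ b - 1"
  defines "G \<equiv> {g. g \<subseteq> U \<and> card g = w}"
    and "H \<equiv> {T. T \<subseteq> U \<and> card T \<in> {0, 7 ^ a - 1, 73 ^ b - 1}}"
  shows "matching_code G (H \<rightarrow>\<^sub>E {..<511}) (\<lambda>x g. lfsr (\<Sum>T\<in>{T\<in>H. T \<subseteq> g}. x T))"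
proof -
  define Y where "Y = H \<rightarrow>\<^sub>E {..<511::nat}"
  define F where "F = (\<lambda>x g. lfsr (\<Sum>T\<in>{T\<in>H. T \<subseteq> g}. x T))"
  define v where "v = (\<lambda>(g :: 'u set) c d T. (if T = {} then c + d else 0) +
     (if T \<subseteq> g then d * (146 * of_bool (card T = 7 ^ a - 1) + 364 * of_bool (card T = 73 ^ b - 1)) else 0 :: nat))"
  have finH: "finite H" using U by (auto simp: H_def)
  then have finHh: "finite {T \<in> H. T \<subseteq> h}" for h by simp
  have finY: "finite Y" unfolding Y_def using finH by (intro finite_PiE) auto
  have fin: "finite h" if "h \<in> G" for h using that U by (auto simp: G_def intro: finite_subset)
  have sum_v: "(\<Sum>T\<in>{T\<in>H. T \<subseteq> h}. v g c d T) = c + d * (1 + 146 * (card (g \<inter> h) choose (7 ^ a - 1))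
       + 364 * (card (g \<inter> h) choose (73 ^ b - 1)))" if g: "g \<in> G" and h: "h \<in> G" for g h c d
  proof -
    have card_eq: "(\<Sum>T\<in>{T\<in>H. T \<subseteq> h}. if T \<subseteq> g then d * (k * of_bool (card T = D)) else 0) = d * k * (card (g \<inter> h) choose D)"
      if "D \<in> {0, 7 ^ a - 1, 73 ^ b - 1}" for k D
    proof -
      have fgh: "finite (g \<inter> h)" using fin[OF g] by simp
      have "(\<Sum>T\<in>{T\<in>H. T \<subseteq> h}. if T \<subseteq> g then d * (k * of_bool (card T = D)) else 0)
          = (\<Sum>T\<in>{T. T \<subseteq> g \<inter> h \<and> card T = D}. d * k)"
        using that g h by (intro sum.mono_neutral_cong_right[OF finHh]) (auto simp: H_def G_def)
      also have "\<dots> = d * k * (card (g \<inter> h) choose D)"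
        using n_subsets[OF fgh, of D] by (simp only: sum_constant of_nat_id mult.commute)
      finally show ?thesis .
    qed
    have e: "{} \<in> {T\<in>H. T \<subseteq> h}" by (auto simp: H_def)
    have "(\<Sum>T\<in>{T\<in>H. T \<subseteq> h}. v g c d T) = (\<Sum>T\<in>{T\<in>H. T \<subseteq> h}. if T = {} then c + d else 0)
       + (\<Sum>T\<in>{T\<in>H. T \<subseteq> h}. if T \<subseteq> g then d * (146 * of_bool (card T = 7 ^ a - 1)) else 0)
       + (\<Sum>T\<in>{T\<in>H. T \<subseteq> h}. if T \<subseteq> g then d * (364 * of_bool (card T = 73 ^ b - 1)) else 0)"
      unfolding v_def sum.distrib[symmetric]
      by (intro sum.cong) (auto simp: distrib_left)
    also have "(\<Sum>T\<in>{T\<in>H. T \<subseteq> h}. if T = {} then c + d else 0) = c + d"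
      using e finH by (subst sum.delta) auto
    finally show ?thesis by (subst (asm) (1 2) card_eq) (auto simp: algebra_simps)
  qed
  have F_translate: "F (translate H (v g c d) x) h = lfsr ((\<Sum>T\<in>{T\<in>H. T \<subseteq> h}. x T) +
       (c + d * (1 + 146 * (card (g \<inter> h) choose (7 ^ a - 1)) + 364 * (card (g \<inter> h) choose (73 ^ b - 1)))))"
    if "g \<in> G" "h \<in> G" for g h c d x
    unfolding F_def using sum_v[OF that] by (subst sum_translate_mod) auto
  have pos: "7 ^ a * 73 ^ b > (0::nat)" by simp
  show ?thesis
    unfolding matching_code_def Y_def[symmetric] F_def[symmetric]
  proof
    fix g assume g: "g \<in> G"
    define M where "M = {x\<in>Y. F x g}"
    let ?s1 = "translate H (v g 341 0)" and ?s2 = "translate H (v g 192 3)"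
      and ?s3 = "translate H (v g 489 144)"
    have MY: "M \<subseteq> Y" by (auto simp: M_def)
    have closed: "translate H u \<in> M \<rightarrow> Y" for u
      unfolding Y_def by (intro Pi_I translate_closed)
    have inj: "inj_on (translate H u) M" for u
      using inj_on_translate MY unfolding Y_def by (rule inj_on_subset)
    have "Y \<subseteq> (\<Union>d\<in>{..<9}. {x\<in>Y. translate H (v g d 0) x \<in> M})"
    proof
      fix x assume x: "x \<in> Y"
      obtain d where "d < 9" "lfsr ((\<Sum>T\<in>{T\<in>H. T \<subseteq> g}. x T) + d)"
        using lfsr_nonzero_window[of "\<Sum>T\<in>{T\<in>H. T \<subseteq> g}. x T"] by blast
      then have "F (translate H (v g d 0) x) g" by (simp add: F_translate[OF g g])
      then show "x \<in> (\<Union>d\<in>{..<9}. {x\<in>Y. translate H (v g d 0) x \<in> M})"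
        using x \<open>d < 9\<close> translate_closed[of H "v g d 0" x, folded Y_def] by (auto simp: M_def)
    qed
    then have "card Y \<le> card (\<Union>d\<in>{..<9}. {x\<in>Y. translate H (v g d 0) x \<in> M})"
      using finY by (intro card_mono) auto
    also have "\<dots> \<le> (\<Sum>d<9. card {x\<in>Y. translate H (v g d 0) x \<in> M})"
      by (rule card_UN_le) simp
    also have "\<dots> \<le> (\<Sum>d<(9::nat). card M)"
    proof (rule sum_mono)
      fix d
      show "card {x\<in>Y. translate H (v g d 0) x \<in> M} \<le> card M"
        using finite_subset[OF MY finY] inj_on_translate[of H "v g d 0"]
        by (intro card_inj_on_le[where f = "translate H (v g d 0)"]) (auto simp: Y_def intro: inj_on_subset)
    qed
    finally have card: "card Y \<le> 9 * card M" by simp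
    have decode: "(F (?s1 y) h \<noteq> (F (?s2 y) h \<noteq> F (?s3 y) h)) \<longleftrightarrow> h = g" if y: "y \<in> M" and h: "h \<in> G" for y h
    proof -
      define s where "s = 1 + 146 * (card (g \<inter> h) choose (7 ^ a - 1)) + 364 * (card (g \<inter> h) choose (73 ^ b - 1))"
      have le: "card (g \<inter> h) \<le> w" using card_mono[OF fin[OF g], of "g \<inter> h"] g by (auto simp: G_def)
      then have lt: "card (g \<inter> h) < 7 ^ a * 73 ^ b" using pos unfolding w_def by linarith
      have "(F (?s1 y) h \<noteq> (F (?s2 y) h \<noteq> F (?s3 y) h)) \<longleftrightarrow> s mod 511 = 0 \<and> lfsr (\<Sum>T\<in>{T\<in>H. T \<subseteq> h}. y T)"
        unfolding F_translate[OF g h] s_def[symmetric] mult_0 add_0_right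
        by (rule lfsr_decode) (unfold s_def, rule mod_511_representation(1))
      also have "s mod 511 = 0 \<longleftrightarrow> card (g \<inter> h) = w"
        using mod_511_representation(2)[OF lt] pos unfolding s_def w_def by linarith
      also have "\<dots> \<longleftrightarrow> h = g"
        using g h fin[OF g] fin[OF h] by (auto simp: G_def) (metis card_subset_eq inf_le1 inf_le2)+
      finally show ?thesis using y by (auto simp: M_def F_def)
    qed
    show "\<exists>M s\<^sub>1 s\<^sub>2 s\<^sub>3. M \<subseteq> Y \<and> card Y \<le> 9 * card M \<and>
       s\<^sub>1 \<in> M \<rightarrow> Y \<and> inj_on s\<^sub>1 M \<and> s\<^sub>2 \<in> M \<rightarrow> Y \<and> inj_on s\<^sub>2 M \<and> s\<^sub>3 \<in> M \<rightarrow> Y \<and> inj_on s\<^sub>3 M \<and>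
       (\<forall>y\<in>M. \<forall>h\<in>G. (F (s\<^sub>1 y) h \<noteq> (F (s\<^sub>2 y) h \<noteq> F (s\<^sub>3 y) h)) \<longleftrightarrow> h = g)"
      using MY card closed inj decode by (intro exI[of _ M] exI[of _ ?s1] exI[of _ ?s2] exI[of _ ?s3]) blast
  qed
qed

section \<open>The derivative at 0 by quadrature\<close>

lemma sum_cis_roots:
  fixes d :: int and N :: nat
  assumes "\<bar>d\<bar> < int N"
  shows "(\<Sum>s<N. cis (of_int d * (2 * pi * real s / real N))) = (if d = 0 then of_nat N else 0)"
proof (cases "d = 0")
  case False
  have N: "N > 0" using assms by simp
  define z where "z = cis (2 * pi * of_int d / real N)"
  have pow: "cis (of_int d * (2 * pi * real s / real N)) = z ^ s" for s
    unfolding z_def Complex.DeMoivre by (rule arg_cong[of _ _ cis]) simp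
  have "z \<noteq> 1"
  proof
    assume "z = 1"
    then have "cos (2 * pi * of_int d / real N) = 1" by (simp add: z_def complex_eq_iff)
    then obtain k :: int where "2 * pi * of_int d / real N = of_int k * 2 * pi"
      by (auto simp: cos_one_2pi_int)
    then have "real_of_int d = of_int k * real N" using N by (simp add: field_simps)
    then have "d = k * int N" by (metis of_int_eq_iff of_int_mult of_int_of_nat_eq)
    then have "int N dvd d" by simp
    then have "\<bar>int N\<bar> \<le> \<bar>d\<bar>" using False by (rule dvd_imp_le_int[rotated])
    then show False using assms by simp
  qed
  moreover have "z ^ N = 1"
    using N by (simp add: z_def Complex.DeMoivre)
  ultimately show ?thesis using False unfolding pow by (simp add: geometric_sum)
qed simp

lemma cis_diff_power:
  "(cis t - cis (-t)) ^ j = (\<Sum>r\<le>j. (-1) ^ r * of_nat (j choose r) * cis (of_int (int j - 2 * int r) * t))"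
proof -
  have "(cis t - cis (-t)) ^ j = (- cis (-t) + cis t) ^ j" by simp
  also have "\<dots> = (\<Sum>r\<le>j. of_nat (j choose r) * (- cis (-t)) ^ r * cis t ^ (j - r))"
    by (rule binomial_ring)
  also have "\<dots> = (\<Sum>r\<le>j. (-1) ^ r * of_nat (j choose r) * cis (of_int (int j - 2 * int r) * t))"
  proof (intro sum.cong refl)
    fix r assume "r \<in> {..j}"
    then have "(- cis (-t)) ^ r * cis t ^ (j - r) = (-1) ^ r * cis (of_int (int j - 2 * int r) * t)"
      unfolding power_minus[of "cis (-t)"] Complex.DeMoivre cis_mult mult.assoc
      by (intro arg_cong2[of _ _ _ _ "(*)"] arg_cong[of _ _ cis]) (simp_all add: of_nat_diff algebra_simps)
    then show "of_nat (j choose r) * (- cis (-t)) ^ r * cis t ^ (j - r) =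
      (-1) ^ r * of_nat (j choose r) * cis (of_int (int j - 2 * int r) * t)"
      by (simp add: mult.assoc mult.left_commute)
  qed
  finally show ?thesis .
qed

text \<open>The weights express the derivative at 0 of a trigonometric polynomial \<open>p\<close> of degree at most
  \<open>m\<close> through its values at the roots of unity of order \<open>2 * m + 1\<close>; they are applied to
  \<open>p t = sin t ^ j\<close>.\<close>

lemma derivative_quadrature:
  fixes m :: nat
  obtains w :: "nat \<Rightarrow> real" and \<rho> :: "nat \<Rightarrow> real" and N :: nat
  where "\<And>s. \<bar>\<rho> s\<bar> \<le> 1" and "(\<Sum>s<N. \<bar>w s\<bar>) \<le> real (m * (2 * m + 1))"
    and "\<And>j. j \<le> m \<Longrightarrow> (\<Sum>s<N. w s * \<rho> s ^ j) = of_bool (j = 1)"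
proof -
  define N where "N = 2 * m + 1"
  define \<theta> where "\<theta> s = 2 * pi * real s / real N" for s
  define L where "L = {- int m..int m}"
  define v where "v s = (1 / of_nat N) * (\<Sum>l\<in>L. \<i> * of_int l * cis (- of_int l * \<theta> s))" for s
  have N: "N > 0" by (simp add: N_def)
  have card_L: "card L = N" by (simp add: L_def N_def)
  have v_cis: "(\<Sum>s<N. v s * cis (of_int d * \<theta> s)) = \<i> * of_int d" if d: "d \<in> L" for d
  proof -
    have "(\<Sum>s<N. v s * cis (of_int d * \<theta> s)) =
        (\<Sum>s<N. \<Sum>l\<in>L. (\<i> * of_int l / of_nat N) * cis (of_int (d - l) * \<theta> s))"
      by (intro sum.cong refl)
        (simp add: v_def sum_distrib_left sum_distrib_right cis_mult mult.assoc algebra_simps sum_divide_distrib)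
    also have "\<dots> = (\<Sum>l\<in>L. (\<i> * of_int l / of_nat N) * (\<Sum>s<N. cis (of_int (d - l) * \<theta> s)))"
      by (subst sum.swap) (simp add: sum_distrib_left)
    also have "\<dots> = (\<Sum>l\<in>L. if l = d then \<i> * of_int d else 0)"
    proof (intro sum.cong refl)
      fix l assume "l \<in> L"
      then have "\<bar>d - l\<bar> < int N" using d by (auto simp: L_def N_def)
      from sum_cis_roots[OF this] show "(\<i> * of_int l / of_nat N) * (\<Sum>s<N. cis (of_int (d - l) * \<theta> s))
          = (if l = d then \<i> * of_int d else 0)"
        using N by (simp add: \<theta>_def)
    qed
    also have "\<dots> = \<i> * of_int d" using d by (simp add: L_def)
    finally show ?thesis .
  qed
  have v_sin: "(\<Sum>s<N. v s * of_real (sin (\<theta> s) ^ j)) = of_bool (j = 1)" if j: "j \<le> m" for j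
  proof -
    have "(2 * \<i>) ^ j * (\<Sum>s<N. v s * of_real (sin (\<theta> s) ^ j)) = (\<Sum>s<N. v s * (cis (\<theta> s) - cis (- \<theta> s)) ^ j)"
    proof -
      have "cis t - cis (-t) = 2 * \<i> * of_real (sin t)" for t by (simp add: complex_eq_iff)
      then show ?thesis by (simp add: sum_distrib_left power_mult_distrib mult.left_commute)
    qed
    also have "\<dots> = (\<Sum>s<N. \<Sum>r\<le>j. (-1) ^ r * of_nat (j choose r) * (v s * cis (of_int (int j - 2 * int r) * \<theta> s)))"
      by (simp add: cis_diff_power sum_distrib_left mult.left_commute)
    also have "\<dots> = (\<Sum>r\<le>j. (-1) ^ r * of_nat (j choose r) * (\<Sum>s<N. v s * cis (of_int (int j - 2 * int r) * \<theta> s)))"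
      by (subst sum.swap) (simp add: sum_distrib_left)
    also have "\<dots> = (\<Sum>r\<le>j. (-1) ^ r * of_nat (j choose r) * (\<i> * of_int (int j - 2 * int r)))"
      using j by (intro sum.cong refl arg_cong2[of _ _ _ _ "(*)"] v_cis) (auto simp: L_def)
    also have "\<dots> = \<i> * of_nat j * (\<Sum>r\<le>j. (-1) ^ r * of_nat (j choose r))
         - 2 * \<i> * (\<Sum>r\<le>j. (-1) ^ r * of_nat r * of_nat (j choose r))"
      by (simp add: sum_distrib_left sum_subtractf[symmetric] algebra_simps)
    also have "\<dots> = (2 * \<i>) ^ j * of_bool (j = 1)"
    proof -
      consider "j = 0" | "j = 1" | "j > 1" by linarith
      then show ?thesis
      proof cases
        case 3
        then have "j \<noteq> 1" "j > 0" by auto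
        then show ?thesis using choose_alternating_sum[of j, where ?'a = complex]
          choose_alternating_linear_sum[of j, where ?'a = complex] by (simp only:) simp
      qed auto
    qed
    finally show ?thesis by simp
  qed
  define w where "w s = Re (v s)" for s
  have "(\<Sum>s<N. w s * sin (\<theta> s) ^ j) = of_bool (j = 1)" if "j \<le> m" for j
    using arg_cong[OF v_sin[OF that], of Re] by (simp add: w_def Re_sum)
  moreover have "(\<Sum>s<N. \<bar>w s\<bar>) \<le> real (m * (2 * m + 1))"
  proof -
    have "\<bar>w s\<bar> \<le> real m" for s
    proof -
      have "\<bar>w s\<bar> \<le> norm (v s)" unfolding w_def by (rule abs_Re_le_cmod)
      also have "\<dots> = (1 / real N) * norm (\<Sum>l\<in>L. \<i> * of_int l * cis (- of_int l * \<theta> s))"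
        by (simp add: v_def norm_mult norm_divide)
      also have "norm (\<Sum>l\<in>L. \<i> * of_int l * cis (- of_int l * \<theta> s)) \<le> (\<Sum>l\<in>L. real m)"
        by (intro order.trans[OF norm_sum] sum_mono) (auto simp: norm_mult L_def)
      also have "(1 / real N) * (\<Sum>l\<in>L. real m) = real m"
        using N card_L by simp
      finally show ?thesis by (simp add: divide_right_mono mult_left_mono)
    qed
    then have "(\<Sum>s<N. \<bar>w s\<bar>) \<le> (\<Sum>s<N. real m)" by (intro sum_mono)
    then show ?thesis by (simp add: N_def algebra_simps)
  qed
  ultimately show ?thesis using that[of "\<lambda>s. sin (\<theta> s)" w N] by simp
qed

section \<open>Symmetric seminorms on tensors\<close>

lemma inj_on_extend_permutes:
  assumes "finite S" "M \<subseteq> S" "f ` M \<subseteq> S" "inj_on f M"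
  obtains p where "p permutes S" "\<And>x. x \<in> M \<Longrightarrow> p x = f x"
proof -
  have "finite M" using assms(1,2) by (rule rev_finite_subset)
  then have "card (S - M) = card (S - f ` M)"
    using assms by (simp add: card_Diff_subset card_image)
  then obtain h where h: "bij_betw h (S - M) (S - f ` M)"
    using finite_same_card_bij[of "S - M" "S - f ` M"] assms(1) by auto
  have "bij_betw (\<lambda>x. if x \<in> M then f x else h x) (M \<union> (S - M)) (f ` M \<union> (S - f ` M))"
    using h assms(4) by (intro bij_betw_disjoint_Un) (auto simp: inj_on_imp_bij_betw)
  moreover have "M \<union> (S - M) = S" "f ` M \<union> (S - f ` M) = S" using assms by auto
  ultimately have "bij_betw (\<lambda>x. if x \<in> M then f x else h x) S S" by simp
  then have "bij_betw (\<lambda>x. if x \<in> S then if x \<in> M then f x else h x else x) S S"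
    by (simp cong: bij_betw_cong)
  then have "(\<lambda>x. if x \<in> S then if x \<in> M then f x else h x else x) permutes S"
    by (rule bij_imp_permutes) auto
  then show thesis by (rule that) (use assms(2) in auto)
qed

lemma sum_over_permutations:
  fixes g :: "'a \<Rightarrow> real"
  assumes "finite S" "i \<in> S"
  shows "real (card S) * (\<Sum>p | p permutes S. g (p i)) = fact (card S) * (\<Sum>x\<in>S. g x)"
proof -
  have swap: "(\<Sum>p | p permutes S. g (p j)) = (\<Sum>p | p permutes S. g (p i))" if "j \<in> S" for j
  proof -
    have tp: "Transposition.transpose i j permutes S" using assms that by (intro permutes_swap_id)
    have "(\<Sum>p | p permutes S. g (p j)) = (\<Sum>p | p permutes S. g ((p \<circ> Transposition.transpose i j) j))"
      by (rule sum_permutations_compose_right[OF tp])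
    then show ?thesis by simp
  qed
  have "real (card S) * (\<Sum>p | p permutes S. g (p i)) = (\<Sum>j\<in>S. \<Sum>p | p permutes S. g (p j))"
    using swap by simp
  also have "\<dots> = (\<Sum>p | p permutes S. \<Sum>j\<in>S. g (p j))" by (rule sum.swap)
  also have "\<dots> = (\<Sum>p | p permutes S. \<Sum>x\<in>S. g x)"
  proof (rule sum.cong)
    show "(\<Sum>j\<in>S. g (p j)) = (\<Sum>x\<in>S. g x)" if "p \<in> {p. p permutes S}" for p
      using that by (intro sum.reindex_bij_betw permutes_imp_bij) simp
  qed simp
  finally show ?thesis using assms by (simp add: card_permutations)
qed

definition sign_vec :: "'a set \<Rightarrow> 'a \<Rightarrow> real" where
  "sign_vec X i = (if i \<in> X then -1 else 1)"

lemma sign_vec_mem [simp]: "sign_vec X \<in> A \<rightarrow> {-1, 1}"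
  by (auto simp: sign_vec_def)

lemma sum_sign_vec_mult:
  assumes "finite S" "i \<in> S"
  shows "(\<Sum>X\<in>Pow S. sign_vec X i * sign_vec X k) = (if i = k then 2 ^ card S else 0)"
proof (cases "i = k")
  case True
  have "sign_vec X i * sign_vec X k = 1" for X using True by (simp add: sign_vec_def)
  then show ?thesis using True assms by (simp add: card_Pow)
next
  case False
  let ?flip = "\<lambda>X. if i \<in> X then X - {i} else insert i X"
  have "(\<Sum>X\<in>Pow S. sign_vec X i * sign_vec X k) = (\<Sum>X\<in>Pow S. sign_vec (?flip X) i * sign_vec (?flip X) k)"
    using assms by (intro sum.reindex_bij_witness[of _ ?flip ?flip]) (auto simp: insert_absorb)
  also have "\<dots> = - (\<Sum>X\<in>Pow S. sign_vec X i * sign_vec X k)"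
    unfolding sum_negf[symmetric] using False by (intro sum.cong refl) (auto simp: sign_vec_def)
  finally show ?thesis using False by simp
qed

locale symmetric_tensor_seminorm =
  fixes n :: nat and K :: real and N :: "(nat \<Rightarrow> nat \<Rightarrow> nat \<Rightarrow> real) \<Rightarrow> real"
  assumes K: "K \<ge> 1"
    and N_add: "\<And>A B. N (\<lambda>i j k. A i j k + B i j k) \<le> N A + N B"
    and N_scale: "\<And>c A. N (\<lambda>i j k. c * A i j k) = \<bar>c\<bar> * N A"
    and N_cong: "\<And>A B. (\<And>i j k. i \<in> {1..n} \<Longrightarrow> j \<in> {1..n} \<Longrightarrow> k \<in> {1..n} \<Longrightarrow> A i j k = B i j k) \<Longrightarrow> N A = N B"
    and N_symmetric: "\<And>\<pi> \<sigma> \<tau> \<epsilon> \<delta> \<eta> A. \<pi> permutes {1..n} \<Longrightarrow> \<sigma> permutes {1..n} \<Longrightarrow> \<tau> permutes {1..n} \<Longrightarrow>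
        \<epsilon> \<in> {1..n} \<rightarrow> {-1, 1} \<Longrightarrow> \<delta> \<in> {1..n} \<rightarrow> {-1, 1} \<Longrightarrow> \<eta> \<in> {1..n} \<rightarrow> {-1, 1} \<Longrightarrow>
        N (\<lambda>i j k. \<epsilon> i * \<delta> j * \<eta> k * A (\<pi> i) (\<sigma> j) (\<tau> k)) \<le> K * N A"
begin

lemma N_zero: "N (\<lambda>i j k. 0) = 0"
  using N_scale[of 0 "\<lambda>i j k. 0"] by simp

lemma N_nonneg: "N A \<ge> 0"
  using N_add[of A "\<lambda>i j k. (-1) * A i j k"] N_scale[of "-1" A] N_zero by simp

lemma N_sum_le:
  assumes "\<And>s. s \<in> S \<Longrightarrow> N (A s) \<le> B"
  shows "N (\<lambda>i j k. \<Sum>s\<in>S. w s * A s i j k) \<le> (\<Sum>s\<in>S. \<bar>w s\<bar>) * B"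
  using assms
proof (induction S rule: infinite_finite_induct)
  case (insert x S)
  have "N (\<lambda>i j k. w x * A x i j k + (\<Sum>s\<in>S. w s * A s i j k)) \<le> \<bar>w x\<bar> * N (A x) + (\<Sum>s\<in>S. \<bar>w s\<bar>) * B"
    using insert N_add[of "\<lambda>i j k. w x * A x i j k" "\<lambda>i j k. \<Sum>s\<in>S. w s * A s i j k"]
    by (simp add: N_scale)
  also have "\<dots> \<le> \<bar>w x\<bar> * B + (\<Sum>s\<in>S. \<bar>w s\<bar>) * B"
    using insert.prems by (intro add_right_mono mult_left_mono) auto
  finally show ?case using insert.hyps by (simp add: distrib_right)
qed (simp_all add: N_zero)

definition box :: real where "box = K * N (\<lambda>i j k. 1)"

lemma box_nonneg: "box \<ge> 0"
  using K N_nonneg by (simp add: box_def)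

lemma N_sign_tensor:
  assumes "x \<in> {1..n} \<rightarrow> {-1, 1}" "y \<in> {1..n} \<rightarrow> {-1, 1}" "z \<in> {1..n} \<rightarrow> {-1, 1}"
  shows "N (\<lambda>i j k. x i * y j * z k) \<le> box"
  using N_symmetric[OF permutes_id permutes_id permutes_id assms, of "\<lambda>i j k. 1"] by (simp add: box_def)

lemma N_half_diff:
  assumes "N A \<le> B" "N A' \<le> B"
  shows "N (\<lambda>i j k. (A i j k - A' i j k) / 2) \<le> B"
proof -
  have "N (\<lambda>i j k. (A i j k - A' i j k) / 2) = N (\<lambda>i j k. (1/2) * A i j k + (-1/2) * A' i j k)"
    by (rule arg_cong[of _ _ N]) (simp add: fun_eq_iff field_simps)
  also have "\<dots> \<le> \<bar>1/2\<bar> * N A + \<bar>-1/2\<bar> * N A'"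
    unfolding N_scale[symmetric] by (rule N_add)
  also have "\<dots> \<le> B" using assms by simp
  finally show ?thesis .
qed

lemma N_unit: "N (\<lambda>i j k. of_bool (i = a \<and> j = b \<and> k = c)) \<le> box"
proof -
  have 1: "N (\<lambda>i j k. of_bool (i = a) * sign_vec Y j * sign_vec Z k) \<le> box" for Y Z
  proof -
    have "(\<lambda>i j k. of_bool (i = a) * sign_vec Y j * sign_vec Z k) =
      (\<lambda>i j k. (sign_vec {} i * sign_vec Y j * sign_vec Z k - sign_vec {a} i * sign_vec Y j * sign_vec Z k) / 2)"
      by (auto simp: fun_eq_iff sign_vec_def)
    then show ?thesis by (simp only:) (intro N_half_diff N_sign_tensor sign_vec_mem)
  qed
  have 2: "N (\<lambda>i j k. of_bool (i = a) * of_bool (j = b) * sign_vec Z k) \<le> box" for Z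
  proof -
    have "(\<lambda>i j k. of_bool (i = a) * of_bool (j = b) * sign_vec Z k) =
      (\<lambda>i j k. (of_bool (i = a) * sign_vec {} j * sign_vec Z k - of_bool (i = a) * sign_vec {b} j * sign_vec Z k) / 2)"
      by (auto simp: fun_eq_iff sign_vec_def)
    then show ?thesis by (simp only:) (intro N_half_diff 1)
  qed
  have "(\<lambda>i j k. of_bool (i = a \<and> j = b \<and> k = c)) =
      (\<lambda>i j k. (of_bool (i = a) * of_bool (j = b) * sign_vec {} k - of_bool (i = a) * of_bool (j = b) * sign_vec {c} k) / 2)"
    by (auto simp: fun_eq_iff sign_vec_def)
  then show ?thesis by (simp only:) (intro N_half_diff 2)
qed

lemma N_entrywise_le:
  assumes "\<And>i j k. i \<in> {1..n} \<Longrightarrow> j \<in> {1..n} \<Longrightarrow> k \<in> {1..n} \<Longrightarrow> \<bar>A i j k\<bar> \<le> \<theta>"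
  shows "N A \<le> (real n ^ 3 * \<theta>) * box"
proof -
  let ?I = "{1..n} \<times> {1..n} \<times> {1..n}"
  have "N A = N (\<lambda>i j k. \<Sum>(a, b, c)\<in>?I. A a b c * of_bool (i = a \<and> j = b \<and> k = c))"
  proof (rule N_cong)
    fix i j k assume ijk: "i \<in> {1..n}" "j \<in> {1..n}" "k \<in> {1..n}"
    have "(\<Sum>(a, b, c)\<in>?I. A a b c * of_bool (i = a \<and> j = b \<and> k = c)) =
        (\<Sum>p\<in>?I. if p = (i, j, k) then A i j k else 0)"
      by (intro sum.cong) auto
    also have "\<dots> = A i j k" using ijk by (subst sum.delta) auto
    finally show "A i j k = (\<Sum>(a, b, c)\<in>?I. A a b c * of_bool (i = a \<and> j = b \<and> k = c))" ..
  qed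
  also have "\<dots> = N (\<lambda>i j k. \<Sum>p\<in>?I. (case p of (a, b, c) \<Rightarrow> A a b c) *
       (case p of (a, b, c) \<Rightarrow> of_bool (i = a \<and> j = b \<and> k = c)))"
    by (simp add: case_prod_unfold)
  also have "\<dots> \<le> (\<Sum>p\<in>?I. \<bar>case p of (a, b, c) \<Rightarrow> A a b c\<bar>) * box"
    by (rule N_sum_le[where A = "\<lambda>p i j k. case p of (a, b, c) \<Rightarrow> of_bool (i = a \<and> j = b \<and> k = c)"])
      (auto simp: N_unit)
  also have "\<dots> \<le> (\<Sum>p\<in>?I. \<theta>) * box"
    using assms box_nonneg by (intro mult_right_mono sum_mono) auto
  also have "(\<Sum>p\<in>?I. \<theta>) = real n ^ 3 * \<theta>"
    by (simp add: card_cartesian_product power3_eq_cube)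
  finally show ?thesis .
qed

text \<open>Averaging over sign patterns \<open>\<epsilon>\<close>, \<open>\<delta>\<close>, \<open>\<epsilon> * \<delta>\<close> in the three coordinates keeps the diagonal and
  kills everything else.\<close>

lemma N_diagonal_part:
  assumes "\<pi> permutes {1..n}" "\<sigma> permutes {1..n}" "\<tau> permutes {1..n}"
  shows "N (\<lambda>i j k. of_bool (i = j \<and> j = k) * A (\<pi> i) (\<sigma> i) (\<tau> i)) \<le> K * N A"
proof -
  let ?P = "Pow {1..n} \<times> Pow {1..n}"
  let ?D = "\<lambda>p i j k. sign_vec (fst p) i * sign_vec (snd p) j * (sign_vec (fst p) k * sign_vec (snd p) k) * A (\<pi> i) (\<sigma> j) (\<tau> k)"
  have "N (\<lambda>i j k. of_bool (i = j \<and> j = k) * A (\<pi> i) (\<sigma> i) (\<tau> i)) = N (\<lambda>i j k. \<Sum>p\<in>?P. (1 / 4 ^ n) * ?D p i j k)"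
  proof (rule N_cong)
    fix i j k assume ijk: "i \<in> {1..n}" "j \<in> {1..n}" "k \<in> {1..n}"
    have "(\<Sum>p\<in>?P. (1 / 4 ^ n) * ?D p i j k) = (1 / 4 ^ n) * A (\<pi> i) (\<sigma> j) (\<tau> k) *
       ((\<Sum>X\<in>Pow {1..n}. sign_vec X i * sign_vec X k) * (\<Sum>Y\<in>Pow {1..n}. sign_vec Y j * sign_vec Y k))"
      unfolding sum_product sum.cartesian_product unfolding sum_distrib_left
      by (intro sum.cong) auto
    also have "\<dots> = of_bool (i = j \<and> j = k) * A (\<pi> i) (\<sigma> i) (\<tau> i)"
      using ijk by (simp add: sum_sign_vec_mult power_mult_distrib[symmetric])
    finally show "of_bool (i = j \<and> j = k) * A (\<pi> i) (\<sigma> i) (\<tau> i) = (\<Sum>p\<in>?P. (1 / 4 ^ n) * ?D p i j k)" ..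
  qed
  also have "\<dots> \<le> (\<Sum>p\<in>?P. \<bar>1 / 4 ^ n\<bar>) * (K * N A)"
    by (intro N_sum_le N_symmetric assms) (auto simp: sign_vec_def)
  also have "(\<Sum>p\<in>?P. \<bar>1 / 4 ^ n :: real\<bar>) = 1"
    by (simp add: card_cartesian_product card_Pow power_mult_distrib[symmetric])
  finally show ?thesis by simp
qed

lemma N_diagonal_le_box: "N (\<lambda>i j k. of_bool (i = j \<and> j = k)) \<le> box"
  using N_diagonal_part[OF permutes_id permutes_id permutes_id, of "\<lambda>i j k. 1"] by (simp add: box_def)

lemma N_diagonal_le_matching:
  assumes M: "M \<subseteq> {1..n}"
    and perm: "\<pi> permutes {1..n}" "\<sigma> permutes {1..n}" "\<tau> permutes {1..n}"
    and A: "\<And>i. i \<in> M \<Longrightarrow> A (\<pi> i) (\<sigma> i) (\<tau> i) = 1" "\<And>i j k. A i j k \<ge> 0"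
  shows "real (card M) * N (\<lambda>i j k. of_bool (i = j \<and> j = k)) \<le> real n * (K * N A)"
proof -
  define g where "g x = A (\<pi> x) (\<sigma> x) (\<tau> x)" for x
  define \<Delta> :: "nat \<Rightarrow> nat \<Rightarrow> nat \<Rightarrow> real" where "\<Delta> = (\<lambda>i j k. of_bool (i = j \<and> j = k))"
  define P where "P = {p. p permutes {1..n}}"
  have P: "real (card P) = fact n" unfolding P_def by (simp add: card_permutations)
  have "real (card M) = (\<Sum>x\<in>M. g x)" using A by (simp add: g_def)
  also have "\<dots> \<le> (\<Sum>x\<in>{1..n}. g x)" using M A by (intro sum_mono2) (auto simp: g_def)
  finally have "fact n * real (card M) * N \<Delta> \<le> fact n * (\<Sum>x\<in>{1..n}. g x) * N \<Delta>"
    by (intro mult_right_mono mult_left_mono N_nonneg) auto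
  also have "\<dots> = N (\<lambda>i j k. (fact n * (\<Sum>x\<in>{1..n}. g x)) * \<Delta> i j k)"
    using A by (subst N_scale) (simp add: g_def sum_nonneg)
  also have "\<dots> = N (\<lambda>i j k. \<Sum>p\<in>P. real n * (of_bool (i = j \<and> j = k) * g (p i)))"
  proof (rule N_cong)
    fix i j k assume "i \<in> {1..n}"
    from sum_over_permutations[OF _ this, of g]
    have "fact n * (\<Sum>x\<in>{1..n}. g x) = real n * (\<Sum>p\<in>P. g (p i))" by (simp add: P_def)
    then show "(fact n * (\<Sum>x\<in>{1..n}. g x)) * \<Delta> i j k = (\<Sum>p\<in>P. real n * (of_bool (i = j \<and> j = k) * g (p i)))"
      by (simp add: \<Delta>_def sum_distrib_left)
  qed
  also have "\<dots> \<le> (\<Sum>p\<in>P. \<bar>real n\<bar>) * (K * N A)"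
  proof (rule N_sum_le)
    fix p assume "p \<in> P"
    then have p: "p permutes {1..n}" by (simp add: P_def)
    show "N (\<lambda>i j k. of_bool (i = j \<and> j = k) * g (p i)) \<le> K * N A"
      using N_diagonal_part[OF p[THEN permutes_compose, OF perm(1)] p[THEN permutes_compose, OF perm(2)]
          p[THEN permutes_compose, OF perm(3)], of A] by (simp add: g_def)
  qed
  also have "\<dots> = fact n * (real n * (K * N A))" using P by simp
  finally show ?thesis unfolding \<Delta>_def[symmetric] mult.assoc by (simp only: mult_le_cancel_left_pos[OF fact_gt_zero])
qed

lemma N_noise:
  fixes S :: "nat \<Rightarrow> nat \<Rightarrow> nat \<Rightarrow> 'g set"
  assumes G: "finite G" and S: "\<And>i j k. S i j k = {h\<in>G. F i h \<noteq> (F j h \<noteq> F k h)}"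
    and r: "\<bar>r\<bar> \<le> 1" and e: "e \<in> G \<rightarrow> {-1, 1}"
  shows "N (\<lambda>i j k. \<Prod>h\<in>S i j k. r * e h) \<le> box"
proof -
  define u :: "'g set \<Rightarrow> nat \<Rightarrow> real" where "u X i = (\<Prod>h\<in>G. if F i h \<and> h \<in> X then -1 else 1)" for X i
  define p where "p X = (\<Prod>h\<in>X. (1 - r * e h) / 2) * (\<Prod>h\<in>G - X. (1 + r * e h) / 2)" for X
  have re: "\<bar>r * e h\<bar> \<le> 1" if "h \<in> G" for h
    using e that r by (auto simp: abs_mult Pi_iff)
  have p_nonneg: "p X \<ge> 0" if "X \<in> Pow G" for X
    unfolding p_def using re that by (intro mult_nonneg_nonneg prod_nonneg) (auto simp: abs_le_iff, force+)
  have "(\<Sum>X\<in>Pow G. p X) = (\<Prod>h\<in>G. (1 - r * e h) / 2 + (1 + r * e h) / 2)"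
    unfolding p_def using G by (rule prod_add[symmetric])
  also have "\<dots> = 1" by (intro prod.neutral) (auto simp: field_simps)
  finally have p_sum: "(\<Sum>X\<in>Pow G. \<bar>p X\<bar>) = 1" using p_nonneg by simp
  have u_mem: "u X \<in> A \<rightarrow> {-1, 1}" for X A
  proof
    fix i
    have "u X i = 1 \<or> u X i = -1" unfolding u_def using G by (induction G) auto
    then show "u X i \<in> {-1, 1}" by auto
  qed
  have "(\<Prod>h\<in>S i j k. r * e h) = (\<Sum>X\<in>Pow G. p X * (u X i * u X j * u X k))" for i j k
  proof -
    have u3: "u X i * u X j * u X k = (\<Prod>h\<in>X. if h \<in> S i j k then -1 else 1)" if X: "X \<in> Pow G" for X
    proof -
      have "u X i * u X j * u X k = (\<Prod>h\<in>G. if h \<in> X \<and> h \<in> S i j k then -1 else 1)"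
        unfolding u_def prod.distrib[symmetric] by (intro prod.cong) (auto simp: S)
      also have "\<dots> = (\<Prod>h\<in>X. if h \<in> S i j k then -1 else 1)"
        using X G by (intro prod.mono_neutral_cong_right) auto
      finally show ?thesis .
    qed
    have "(\<Prod>h\<in>S i j k. r * e h) = (\<Prod>h\<in>G. (1 - r * e h) / 2 * (if h \<in> S i j k then -1 else 1) + (1 + r * e h) / 2)"
      using G by (intro prod.mono_neutral_cong_left) (auto simp: S field_simps)
    also have "\<dots> = (\<Sum>X\<in>Pow G. (\<Prod>h\<in>X. (1 - r * e h) / 2 * (if h \<in> S i j k then -1 else 1)) * (\<Prod>h\<in>G - X. (1 + r * e h) / 2))"
      using G by (rule prod_add)
    also have "\<dots> = (\<Sum>X\<in>Pow G. p X * (u X i * u X j * u X k))"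
    proof (rule sum.cong)
      fix X assume "X \<in> Pow G"
      from u3[OF this] show "(\<Prod>h\<in>X. (1 - r * e h) / 2 * (if h \<in> S i j k then -1 else 1)) * (\<Prod>h\<in>G - X. (1 + r * e h) / 2)
          = p X * (u X i * u X j * u X k)"
        unfolding prod.distrib p_def by (simp only: mult_ac)
    qed simp
    finally show ?thesis .
  qed
  then have "N (\<lambda>i j k. \<Prod>h\<in>S i j k. r * e h) = N (\<lambda>i j k. \<Sum>X\<in>Pow G. p X * (u X i * u X j * u X k))"
    by simp
  also have "\<dots> \<le> (\<Sum>X\<in>Pow G. \<bar>p X\<bar>) * box"
    by (intro N_sum_le N_sign_tensor u_mem)
  finally show ?thesis using p_sum by simp
qed

text \<open>This plays the role of Pisier's bound on the Rademacher projection: the part of degree one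
  is a combination of noise operators, up to an error that is negligible in every entry.\<close>

lemma N_linear_part:
  fixes S :: "nat \<Rightarrow> nat \<Rightarrow> nat \<Rightarrow> 'g set"
  assumes G: "finite G" and S: "\<And>i j k. S i j k = {h\<in>G. F i h \<noteq> (F j h \<noteq> F k h)}"
    and e: "e \<in> G \<rightarrow> {-1, 1}"
    and m0: "m > 0" and m: "n ^ 3 * (2 * (m * (2 * m + 1))) \<le> 2 ^ m"
  shows "N (\<lambda>i j k. \<Sum>g\<in>G. e g * of_bool (S i j k = {g})) \<le> (2 * real (m * (2 * m + 1)) + 1) * box"
proof -
  define Q where "Q = real (m * (2 * m + 1))"
  obtain w \<rho> :: "nat \<Rightarrow> real" and L where
    \<rho>: "\<And>s. \<bar>\<rho> s\<bar> \<le> 1" and w: "(\<Sum>s<L. \<bar>w s\<bar>) \<le> Q"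
    and quad: "\<And>j. j \<le> m \<Longrightarrow> (\<Sum>s<L. w s * \<rho> s ^ j) = of_bool (j = 1)"
    unfolding Q_def by (rule derivative_quadrature[of m]) blast
  define \<mu> where "\<mu> j = (\<Sum>s<L. 2 * w s * (\<rho> s / 2) ^ j)" for j
  have lam: "\<mu> j = 2 / 2 ^ j * (\<Sum>s<L. w s * \<rho> s ^ j)" for j
    by (simp add: \<mu>_def sum_distrib_left power_divide mult_ac)
  have lam_small: "\<mu> j = of_bool (j = 1)" if "j \<le> m" for j
    using quad[OF that] by (simp add: lam)
  have lam_large: "\<bar>\<mu> j\<bar> \<le> 2 * Q / 2 ^ m" if "j > m" for j
  proof -
    have "\<bar>\<Sum>s<L. w s * \<rho> s ^ j\<bar> \<le> (\<Sum>s<L. \<bar>w s\<bar>)"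
      using \<rho> by (intro order.trans[OF sum_abs] sum_mono) (auto simp: abs_mult power_abs intro!: mult_left_le power_le_one)
    with w have "\<bar>\<Sum>s<L. w s * \<rho> s ^ j\<bar> \<le> Q" by simp
    then have "\<bar>\<mu> j\<bar> \<le> 2 / 2 ^ j * Q" unfolding lam abs_mult by (intro mult_mono) auto
    also have "\<dots> \<le> 2 / 2 ^ m * Q"
      using that unfolding Q_def by (intro mult_right_mono divide_left_mono power_increasing) auto
    finally show ?thesis by simp
  qed
  define E where "E i j k = (\<Prod>h\<in>S i j k. e h)" for i j k
  define lin where "lin i j k = (\<Sum>g\<in>G. e g * of_bool (S i j k = {g}))" for i j k
  define R where "R i j k = lin i j k - \<mu> (card (S i j k)) * E i j k" for i j k
  have E: "\<bar>E i j k\<bar> \<le> 1" for i j k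
  proof -
    have "\<bar>e h\<bar> = 1" if "h \<in> G" for h using funcset_mem[OF e that] by auto
    then have "\<bar>E i j k\<bar> = (\<Prod>h\<in>S i j k. 1)"
      unfolding E_def abs_prod by (intro prod.cong refl) (simp add: S)
    then show ?thesis by simp
  qed
  have R: "\<bar>R i j k\<bar> \<le> 2 * Q / 2 ^ m" for i j k
  proof (cases "card (S i j k) \<le> m")
    case True
    have "lin i j k = \<mu> (card (S i j k)) * E i j k"
    proof (cases "card (S i j k) = 1")
      case True
      then obtain g where g: "S i j k = {g}" by (auto simp: card_1_singleton_iff)
      then have "g \<in> S i j k" by simp
      then have "g \<in> G" by (simp add: S)
      have "lin i j k = (\<Sum>x\<in>G. if x = g then e g else 0)"
        unfolding lin_def g by (intro sum.cong) auto
      then show ?thesis using lam_small[of 1] \<open>card (S i j k) \<le> m\<close> \<open>g \<in> G\<close> G g by (simp add: E_def)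
    next
      case False
      then have "lin i j k = 0" unfolding lin_def by (intro sum.neutral) auto
      then show ?thesis using False lam_small[OF \<open>card (S i j k) \<le> m\<close>] by simp
    qed
    then show ?thesis by (simp add: R_def Q_def)
  next
    case False
    then have "S i j k \<noteq> {g}" for g using m0 by auto
    then have "lin i j k = 0" unfolding lin_def by (intro sum.neutral) auto
    then have "\<bar>R i j k\<bar> = \<bar>\<mu> (card (S i j k))\<bar> * \<bar>E i j k\<bar>" by (simp add: R_def abs_mult)
    also have "\<dots> \<le> (2 * Q / 2 ^ m) * 1"
      using lam_large[of "card (S i j k)"] False E by (intro mult_mono) (auto simp: Q_def)
    finally show ?thesis by simp
  qed
  have "N R \<le> (real n ^ 3 * (2 * Q / 2 ^ m)) * box"
    by (intro N_entrywise_le R)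
  also have "\<dots> \<le> 1 * box"
  proof (intro mult_right_mono box_nonneg)
    have "real (n ^ 3 * (2 * (m * (2 * m + 1)))) \<le> real (2 ^ m)" using m by (intro of_nat_mono)
    then show "real n ^ 3 * (2 * Q / 2 ^ m) \<le> 1" by (simp add: Q_def field_simps)
  qed
  finally have NR: "N R \<le> box" by simp
  have "N (\<lambda>i j k. \<mu> (card (S i j k)) * E i j k) = N (\<lambda>i j k. \<Sum>s<L. (2 * w s) * (\<Prod>h\<in>S i j k. (\<rho> s / 2) * e h))"
  proof -
    have "(\<Prod>h\<in>S i j k. (\<rho> s / 2) * e h) = (\<rho> s / 2) ^ card (S i j k) * E i j k" for s i j k
      by (simp only: E_def prod.distrib prod_constant)
    then show ?thesis by (simp only: \<mu>_def sum_distrib_right mult.assoc)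
  qed
  also have "\<dots> \<le> (\<Sum>s<L. \<bar>2 * w s\<bar>) * box"
  proof (intro N_sum_le N_noise[where G = G and F = F] G S e)
    show "\<bar>\<rho> s / 2\<bar> \<le> 1" for s using \<rho>[of s] by simp
  qed
  also have "\<dots> \<le> (2 * Q) * box"
    using w box_nonneg by (intro mult_right_mono) (auto simp: abs_mult sum_distrib_left[symmetric])
  finally have "N (\<lambda>i j k. \<mu> (card (S i j k)) * E i j k) \<le> (2 * Q) * box" .
  with NR have "N (\<lambda>i j k. R i j k + \<mu> (card (S i j k)) * E i j k) \<le> box + (2 * Q) * box"
    using N_add[of R "\<lambda>i j k. \<mu> (card (S i j k)) * E i j k"] by linarith
  then show ?thesis by (simp add: R_def lin_def Q_def distrib_right)
qed

lemma N_diagonal_le_code: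
  assumes code: "matching_code G Y F" and Y: "finite Y" "Y \<noteq> {}"
    and \<iota>: "inj_on \<iota> Y" "\<iota> ` Y \<subseteq> {1..n}" and n: "n \<le> 2 * card Y" and g: "g \<in> G"
  defines "F' \<equiv> \<lambda>i. F (inv_into Y \<iota> i)"
  shows "N (\<lambda>i j k. of_bool (i = j \<and> j = k)) \<le>
     18 * (K * N (\<lambda>i j k. of_bool ({h\<in>G. F' i h \<noteq> (F' j h \<noteq> F' k h)} = {g})))"
proof -
  define W :: "nat \<Rightarrow> nat \<Rightarrow> nat \<Rightarrow> real" where "W = (\<lambda>i j k. of_bool ({h\<in>G. F' i h \<noteq> (F' j h \<noteq> F' k h)} = {g}))"
  define \<Delta> :: "nat \<Rightarrow> nat \<Rightarrow> nat \<Rightarrow> real" where "\<Delta> = (\<lambda>i j k. of_bool (i = j \<and> j = k))"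
  from code g obtain M s\<^sub>1 s\<^sub>2 s\<^sub>3 where M: "M \<subseteq> Y" "card Y \<le> 9 * card M"
    and s: "s\<^sub>1 \<in> M \<rightarrow> Y" "inj_on s\<^sub>1 M" "s\<^sub>2 \<in> M \<rightarrow> Y" "inj_on s\<^sub>2 M" "s\<^sub>3 \<in> M \<rightarrow> Y" "inj_on s\<^sub>3 M"
    and dec: "\<forall>y\<in>M. \<forall>h\<in>G. (F (s\<^sub>1 y) h \<noteq> (F (s\<^sub>2 y) h \<noteq> F (s\<^sub>3 y) h)) \<longleftrightarrow> h = g"
    by (rule matching_codeE)
  have inj_M: "inj_on \<iota> M" using \<iota>(1) M(1) by (rule inj_on_subset)
  have inv: "inv_into Y \<iota> (\<iota> y) = y" if "y \<in> Y" for y using \<iota>(1) that by (rule inv_into_f_f)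
  have ext: "\<exists>p. p permutes {1..n} \<and> (\<forall>y\<in>M. p (\<iota> y) = \<iota> (s y))" if "s \<in> M \<rightarrow> Y" "inj_on s M" for s
  proof -
    let ?f = "\<lambda>i. \<iota> (s (inv_into Y \<iota> i))"
    have f_eq: "?f (\<iota> y) = \<iota> (s y)" if "y \<in> M" for y using inv[of y] M(1) that by auto
    have img: "?f ` \<iota> ` M \<subseteq> {1..n}"
      unfolding image_image
    proof (rule image_subsetI)
      fix y assume y: "y \<in> M"
      then have "\<iota> (s y) \<in> \<iota> ` Y" using that(1) by blast
      then show "?f (\<iota> y) \<in> {1..n}" unfolding f_eq[OF y] using \<iota>(2) by blast
    qed
    have inj: "inj_on ?f (\<iota> ` M)"
    proof (rule inj_onI)
      fix i j assume "i \<in> \<iota> ` M" "j \<in> \<iota> ` M" and eq: "?f i = ?f j"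
      then obtain x y where xy: "i = \<iota> x" "j = \<iota> y" "x \<in> M" "y \<in> M" by blast
      have "\<iota> (s x) = \<iota> (s y)" using eq unfolding xy f_eq[OF xy(3)] f_eq[OF xy(4)] .
      then have "s x = s y" by (rule inj_onD[OF \<iota>(1)]) (use that(1) xy in auto)
      then have "x = y" by (rule inj_onD[OF that(2)]) (use xy in auto)
      then show "i = j" using xy by simp
    qed
    have sub: "\<iota> ` M \<subseteq> {1..n}" using \<iota>(2) M(1) by blast
    show ?thesis
    proof (rule inj_on_extend_permutes[OF finite_atLeastAtMost sub img inj])
      fix p assume p: "p permutes {1..n}" "\<And>x. x \<in> \<iota> ` M \<Longrightarrow> p x = ?f x"
      have "p (\<iota> y) = \<iota> (s y)" if "y \<in> M" for y using p(2)[of "\<iota> y"] f_eq[OF that] that by simp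
      with p(1) show ?thesis by blast
    qed
  qed
  obtain \<pi> where \<pi>: "\<pi> permutes {1..n}" "\<And>y. y \<in> M \<Longrightarrow> \<pi> (\<iota> y) = \<iota> (s\<^sub>1 y)"
    using ext[OF s(1,2)] by blast
  obtain \<sigma> where \<sigma>: "\<sigma> permutes {1..n}" "\<And>y. y \<in> M \<Longrightarrow> \<sigma> (\<iota> y) = \<iota> (s\<^sub>2 y)"
    using ext[OF s(3,4)] by blast
  obtain \<tau> where \<tau>: "\<tau> permutes {1..n}" "\<And>y. y \<in> M \<Longrightarrow> \<tau> (\<iota> y) = \<iota> (s\<^sub>3 y)"
    using ext[OF s(5,6)] by blast
  have W1: "W (\<pi> i) (\<sigma> i) (\<tau> i) = 1" if "i \<in> \<iota> ` M" for i
  proof -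
    from that obtain y where y: "i = \<iota> y" "y \<in> M" by auto
    then have F': "F' (\<pi> i) = F (s\<^sub>1 y)" "F' (\<sigma> i) = F (s\<^sub>2 y)" "F' (\<tau> i) = F (s\<^sub>3 y)"
      using funcset_mem[OF s(1)] funcset_mem[OF s(3)] funcset_mem[OF s(5)] \<pi>(2) \<sigma>(2) \<tau>(2)
      by (simp_all add: F'_def inv)
    show ?thesis unfolding W_def F' using bspec[OF dec y(2)] g by auto
  qed
  have "real (card (\<iota> ` M)) * N \<Delta> \<le> real n * (K * N W)"
    unfolding \<Delta>_def using \<iota>(2) M(1) by (intro N_diagonal_le_matching[OF _ \<pi>(1) \<sigma>(1) \<tau>(1)] W1) (auto simp: W_def)
  then have *: "real (card M) * N \<Delta> \<le> real n * (K * N W)" using inj_M by (simp add: card_image)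
  have "card Y > 0" using Y by (simp add: card_gt_0_iff)
  then have "card M > 0" using M(2) by simp
  moreover have "real n \<le> 18 * real (card M)" using n M(2) by linarith
  then have "real n * (K * N W) \<le> 18 * real (card M) * (K * N W)"
    using K N_nonneg by (intro mult_right_mono) auto
  with * have "real (card M) * N \<Delta> \<le> real (card M) * (18 * (K * N W))" by (simp add: mult_ac)
  ultimately show ?thesis unfolding W_def[symmetric] \<Delta>_def[symmetric] by simp
qed

end

section \<open>Cotype constants\<close>

definition tensor_of :: "nat \<Rightarrow> (nat \<Rightarrow> nat \<Rightarrow> nat \<Rightarrow> real) \<Rightarrow> (nat \<times> nat \<times> nat \<Rightarrow>\<^sub>0 real)" where
  "tensor_of n A = (\<Sum>i=1..n. \<Sum>j=1..n. \<Sum>k=1..n. A i j k *\<^sub>R tensor3 (stdbasis i) (stdbasis j) (stdbasis k))"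

lemma tensor_of_mem: "tensor_of n A \<in> tensor_space n"
proof -
  have basis: "stdbasis i \<in> Rn n" if "i \<in> {1..n}" for i
    unfolding Rn_def using that by (intro span_base imageI)
  show ?thesis
    unfolding tensor_of_def tensor_space_def
  proof (intro span_sum span_scale span_base)
    fix i j k assume "i \<in> {1..n}" "j \<in> {1..n}" "k \<in> {1..n}"
    then show "tensor3 (stdbasis i) (stdbasis j) (stdbasis k)
        \<in> {tensor3 x y z |x y z. x \<in> Rn n \<and> y \<in> Rn n \<and> z \<in> Rn n}"
      using basis by blast
  qed
qed

lemma tensor_of_add: "tensor_of n (\<lambda>i j k. A i j k + B i j k) = tensor_of n A + tensor_of n B"
  by (simp add: tensor_of_def scaleR_add_left sum.distrib)

lemma tensor_of_scale: "tensor_of n (\<lambda>i j k. c * A i j k) = c *\<^sub>R tensor_of n A"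
  by (simp add: tensor_of_def scaleR_sum_right)

lemma tensor_of_sum: "tensor_of n (\<lambda>i j k. \<Sum>s\<in>S. w s * A s i j k) = (\<Sum>s\<in>S. w s *\<^sub>R tensor_of n (A s))"
proof (induction S rule: infinite_finite_induct)
  case (insert x S)
  then show ?case
    using tensor_of_add[of n "\<lambda>i j k. w x * A x i j k" "\<lambda>i j k. \<Sum>s\<in>S. w s * A s i j k"]
    by (simp add: tensor_of_scale)
qed (simp_all add: tensor_of_def)

lemma tensor_of_diagonal:
  "tensor_of n (\<lambda>i j k. of_bool (i = j \<and> j = k)) = (\<Sum>i=1..n. tensor3 (stdbasis i) (stdbasis i) (stdbasis i))"
  unfolding tensor_of_def
proof (intro sum.cong refl)
  fix i assume i: "i \<in> {1..n}"
  have "(\<Sum>k=1..n. of_bool (i = j \<and> j = k) *\<^sub>R tensor3 (stdbasis i) (stdbasis j) (stdbasis k)) =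
     (if j = i then tensor3 (stdbasis i) (stdbasis i) (stdbasis i) else 0)" for j
  proof -
    have "(\<Sum>k=1..n. of_bool (i = j \<and> j = k) *\<^sub>R tensor3 (stdbasis i) (stdbasis j) (stdbasis k)) =
      (\<Sum>k=1..n. if k = i then (if j = i then tensor3 (stdbasis i) (stdbasis i) (stdbasis i) else 0) else 0)"
      by (intro sum.cong) auto
    then show ?thesis using i by simp
  qed
  then show "(\<Sum>j=1..n. \<Sum>k=1..n. of_bool (i = j \<and> j = k) *\<^sub>R tensor3 (stdbasis i) (stdbasis j) (stdbasis k))
      = tensor3 (stdbasis i) (stdbasis i) (stdbasis i)" using i by simp
qed

lemma symmetric_tensor_seminorm_tensor_of:
  assumes nrm: "norm_on (tensor_space n) nrm" and sym: "tensor_symmetric n K nrm" and K: "K \<ge> 1"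
  shows "symmetric_tensor_seminorm n K (\<lambda>A. nrm (tensor_of n A))"
proof
  show "nrm (tensor_of n (\<lambda>i j k. A i j k + B i j k)) \<le> nrm (tensor_of n A) + nrm (tensor_of n B)" for A B
    using nrm by (simp add: norm_on_def tensor_of_add tensor_of_mem)
  show "nrm (tensor_of n (\<lambda>i j k. c * A i j k)) = \<bar>c\<bar> * nrm (tensor_of n A)" for c A
    using nrm by (simp add: norm_on_def tensor_of_scale tensor_of_mem)
  show "nrm (tensor_of n A) = nrm (tensor_of n B)"
    if "\<And>i j k. i \<in> {1..n} \<Longrightarrow> j \<in> {1..n} \<Longrightarrow> k \<in> {1..n} \<Longrightarrow> A i j k = B i j k" for A B
    unfolding tensor_of_def using that by (intro arg_cong[of _ _ nrm] sum.cong refl) simp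
  show "nrm (tensor_of n (\<lambda>i j k. \<epsilon> i * \<delta> j * \<eta> k * A (\<pi> i) (\<sigma> j) (\<tau> k))) \<le> K * nrm (tensor_of n A)"
    if "\<pi> permutes {1..n}" "\<sigma> permutes {1..n}" "\<tau> permutes {1..n}"
      "\<epsilon> \<in> {1..n} \<rightarrow> {-1, 1}" "\<delta> \<in> {1..n} \<rightarrow> {-1, 1}" "\<eta> \<in> {1..n} \<rightarrow> {-1, 1}" for \<pi> \<sigma> \<tau> \<epsilon> \<delta> \<eta> A
    using sym that unfolding tensor_symmetric_def tensor_of_def by blast
qed (rule K)

lemma cotype_const_nonneg: "cotype_const V nrm q \<ge> 0"
  unfolding cotype_const_def by (auto intro!: Inf_greatest)

lemma cotype_const_ge:
  fixes x :: "'g \<Rightarrow> 'a::real_vector"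
  assumes G: "finite G" and x: "x \<in> G \<rightarrow> V" and m: "m \<ge> 0" "\<And>g. g \<in> G \<Longrightarrow> m \<le> nrm (x g)"
    and B: "\<And>e. e \<in> G \<rightarrow> {-1, 1} \<Longrightarrow> \<bar>nrm (\<Sum>g\<in>G. e g *\<^sub>R x g)\<bar> \<le> B" and q: "q > 0"
  shows "ereal (real (card G) powr (1 / q) * m / B) \<le> cotype_const V nrm q"
  unfolding cotype_const_def
proof (rule Inf_greatest)
  let ?N = "card G"
  let ?E = "{1..?N} \<rightarrow>\<^sub>E {-1, 1::real}"
  have B0: "B \<ge> 0" using B[of "\<lambda>_. 1"] by simp
  fix z assume "z \<in> ereal ` {C. 0 < C \<and> (\<forall>N (x :: nat \<Rightarrow> 'a). x \<in> {1..N} \<rightarrow> V \<longrightarrow>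
      (\<Sum>i=1..N. nrm (x i) powr q) powr (1 / q) \<le> C * sqrt (measure_pmf.expectation (pmf_of_set ({1..N} \<rightarrow>\<^sub>E {-1, 1::real}))
                 (\<lambda>\<epsilon>. (nrm (\<Sum>i=1..N. \<epsilon> i *\<^sub>R x i))\<^sup>2)))}"
  then obtain C where z: "z = ereal C" and C: "C > 0"
    and cot: "\<And>N (x :: nat \<Rightarrow> 'a). x \<in> {1..N} \<rightarrow> V \<Longrightarrow>
      (\<Sum>i=1..N. nrm (x i) powr q) powr (1 / q) \<le> C * sqrt (measure_pmf.expectation (pmf_of_set ({1..N} \<rightarrow>\<^sub>E {-1, 1::real}))
                 (\<lambda>\<epsilon>. (nrm (\<Sum>i=1..N. \<epsilon> i *\<^sub>R x i))\<^sup>2))" by auto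
  obtain f where f: "bij_betw f {1..?N} G"
    using finite_same_card_bij[of "{1..?N}" G] G by auto
  have fG: "f i \<in> G" if "i \<in> {1..?N}" for i using bij_betwE[OF f] that by auto
  have finE: "finite ?E" "?E \<noteq> {}" by (auto intro: finite_PiE simp: PiE_eq_empty_iff)
  have "measure_pmf.expectation (pmf_of_set ?E) (\<lambda>\<epsilon>. (nrm (\<Sum>i=1..?N. \<epsilon> i *\<^sub>R x (f i)))\<^sup>2)
     = (\<Sum>\<epsilon>\<in>?E. (nrm (\<Sum>i=1..?N. \<epsilon> i *\<^sub>R x (f i)))\<^sup>2) / real (card ?E)"
    using finE by (simp add: integral_pmf_of_set)
  also have "\<dots> \<le> (\<Sum>\<epsilon>\<in>?E. B\<^sup>2) / real (card ?E)"
  proof (intro divide_right_mono sum_mono)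
    fix \<epsilon> assume \<epsilon>: "\<epsilon> \<in> ?E"
    define e where "e = \<epsilon> \<circ> inv_into {1..?N} f"
    have ef: "e (f i) = \<epsilon> i" if "i \<in> {1..?N}" for i
      using f that by (simp add: e_def bij_betw_inv_into_left)
    have "(\<Sum>i=1..?N. \<epsilon> i *\<^sub>R x (f i)) = (\<Sum>i=1..?N. e (f i) *\<^sub>R x (f i))"
      using ef by (intro sum.cong) auto
    also have "\<dots> = (\<Sum>g\<in>G. e g *\<^sub>R x g)" by (rule sum.reindex_bij_betw[OF f])
    finally have *: "(\<Sum>i=1..?N. \<epsilon> i *\<^sub>R x (f i)) = (\<Sum>g\<in>G. e g *\<^sub>R x g)" .
    have "e \<in> G \<rightarrow> {-1, 1}"
    proof
      fix g assume "g \<in> G"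
      then have "inv_into {1..?N} f g \<in> {1..?N}" using bij_betw_inv_into[OF f] by (rule bij_betw_apply[rotated])
      then show "e g \<in> {-1, 1}" using \<epsilon> unfolding e_def o_apply by (rule PiE_mem[rotated])
    qed
    from B[OF this] show "(nrm (\<Sum>i=1..?N. \<epsilon> i *\<^sub>R x (f i)))\<^sup>2 \<le> B\<^sup>2"
      unfolding * using B0 by (simp add: abs_le_square_iff[symmetric])
  qed simp
  also have "\<dots> = B\<^sup>2" using finE by simp
  finally have "sqrt (measure_pmf.expectation (pmf_of_set ?E) (\<lambda>\<epsilon>. (nrm (\<Sum>i=1..?N. \<epsilon> i *\<^sub>R x (f i)))\<^sup>2)) \<le> B"
    using B0 by (simp add: real_le_lsqrt)
  then have "C * sqrt (measure_pmf.expectation (pmf_of_set ?E) (\<lambda>\<epsilon>. (nrm (\<Sum>i=1..?N. \<epsilon> i *\<^sub>R x (f i)))\<^sup>2)) \<le> C * B"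
    using C by (intro mult_left_mono) auto
  then have "(\<Sum>i=1..?N. nrm (x (f i)) powr q) powr (1 / q) \<le> C * B"
    using cot[of "\<lambda>i. x (f i)" ?N] x fG by fastforce
  moreover have "real ?N powr (1 / q) * m = (\<Sum>i=1..?N. m powr q) powr (1 / q)"
    using m(1) q by (simp add: powr_mult powr_powr)
  moreover have "(\<Sum>i=1..?N. m powr q) powr (1 / q) \<le> (\<Sum>i=1..?N. nrm (x (f i)) powr q) powr (1 / q)"
    using m fG q by (intro powr_mono2 sum_mono sum_nonneg) auto
  ultimately have "real ?N powr (1 / q) * m \<le> C * B" by linarith
  then show "ereal (real ?N powr (1 / q) * m / B) \<le> z"
    using C B0 by (cases "B = 0") (auto simp: z divide_le_eq)
qed

lemma cotype_const_ge_1: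
  assumes nrm: "norm_on V nrm" and x: "x \<in> V" "nrm x > 0" and q: "q > 0"
  shows "cotype_const V nrm q \<ge> 1"
proof -
  have "nrm (-1 *\<^sub>R x) = \<bar>-1\<bar> * nrm x" using nrm x unfolding norm_on_def by blast
  then have "ereal (real (card {()}) powr (1 / q) * nrm x / nrm x) \<le> cotype_const V nrm q"
    using x q by (intro cotype_const_ge[where x = "\<lambda>_. x"]) (auto simp: Pi_iff)
  then show ?thesis using x by (simp add: one_ereal_def)
qed

lemma cotype_const_ge_code:
  fixes F :: "'y \<Rightarrow> 'g \<Rightarrow> bool"
  assumes nrm: "norm_on (tensor_space n) nrm" "tensor_symmetric n K nrm" "K \<ge> 1"
    and code: "matching_code G Y F" "finite G" "finite Y" "Y \<noteq> {}" "card Y \<le> n" "n \<le> 2 * card Y"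
    and m: "m > 0" "n ^ 3 * (2 * (m * (2 * m + 1))) \<le> 2 ^ m" and q: "q > 0"
  shows "ereal (real (card G) powr (1 / q) * (nrm (tensor_of n (\<lambda>i j k. of_bool (i = j \<and> j = k))) / (18 * K)) /
     ((2 * real (m * (2 * m + 1)) + 1) * (K * nrm (tensor_of n (\<lambda>i j k. 1))))) \<le> cotype_const (tensor_space n) nrm q"
proof -
  interpret symmetric_tensor_seminorm n K "\<lambda>A. nrm (tensor_of n A)"
    by (rule symmetric_tensor_seminorm_tensor_of) fact+
  obtain \<iota> where \<iota>: "inj_on \<iota> Y" "\<iota> ` Y \<subseteq> {1..n}"
    using card_le_inj[of Y "{1..n}"] code by auto
  define F' where "F' = (\<lambda>i. F (inv_into Y \<iota> i))"
  define S where "S = (\<lambda>i j k. {h\<in>G. F' i h \<noteq> (F' j h \<noteq> F' k h)})"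
  define W where "W = (\<lambda>g i j k. of_bool (S i j k = {g}) :: real)"
  show ?thesis
  proof (rule cotype_const_ge[where x = "\<lambda>g. tensor_of n (W g)"])
    show "nrm (tensor_of n (\<lambda>i j k. of_bool (i = j \<and> j = k))) / (18 * K) \<le> nrm (tensor_of n (W g))" if "g \<in> G" for g
      using N_diagonal_le_code[OF code(1,3,4) \<iota> code(6) that] \<open>K \<ge> 1\<close>
      by (simp add: W_def S_def F'_def divide_le_eq mult_ac)
    show "0 \<le> nrm (tensor_of n (\<lambda>i j k. of_bool (i = j \<and> j = k))) / (18 * K)"
      using N_nonneg \<open>K \<ge> 1\<close> by simp
    fix e :: "'g \<Rightarrow> real" assume e: "e \<in> G \<rightarrow> {-1, 1}"
    have "(\<Sum>g\<in>G. e g *\<^sub>R tensor_of n (W g)) = tensor_of n (\<lambda>i j k. \<Sum>g\<in>G. e g * W g i j k)"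
      by (rule tensor_of_sum[symmetric])
    moreover have "nrm (tensor_of n (\<lambda>i j k. \<Sum>g\<in>G. e g * W g i j k)) \<le> (2 * real (m * (2 * m + 1)) + 1) * box"
      unfolding W_def using code(2) e m by (intro N_linear_part[where F = F']) (auto simp: S_def)
    ultimately show "\<bar>nrm (\<Sum>g\<in>G. e g *\<^sub>R tensor_of n (W g))\<bar> \<le>
        (2 * real (m * (2 * m + 1)) + 1) * (K * nrm (tensor_of n (\<lambda>i j k. 1)))"
      using N_nonneg by (simp add: box_def)
  qed (use code q tensor_of_mem in auto)
qed

section \<open>Choice of the parameters\<close>

lemma matching_code_blocks:
  assumes code: "matching_code G P F" and fin: "finite P"
  shows "matching_code G (B \<times> P) (\<lambda>y. F (snd y))"
  unfolding matching_code_def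
proof
  fix g assume "g \<in> G"
  from code this obtain M s\<^sub>1 s\<^sub>2 s\<^sub>3 where M: "M \<subseteq> P" "card P \<le> 9 * card M"
    and s: "s\<^sub>1 \<in> M \<rightarrow> P" "inj_on s\<^sub>1 M" "s\<^sub>2 \<in> M \<rightarrow> P" "inj_on s\<^sub>2 M" "s\<^sub>3 \<in> M \<rightarrow> P" "inj_on s\<^sub>3 M"
    and dec: "\<forall>y\<in>M. \<forall>h\<in>G. (F (s\<^sub>1 y) h \<noteq> (F (s\<^sub>2 y) h \<noteq> F (s\<^sub>3 y) h)) \<longleftrightarrow> h = g"
    by (rule matching_codeE)
  have lift: "map_prod id s \<in> B \<times> M \<rightarrow> B \<times> P \<and> inj_on (map_prod id s) (B \<times> M)"
    if "s \<in> M \<rightarrow> P" "inj_on s M" for s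
    using that by (auto intro!: map_prod_inj_on inj_on_id)
  show "\<exists>M s\<^sub>1 s\<^sub>2 s\<^sub>3. M \<subseteq> B \<times> P \<and> card (B \<times> P) \<le> 9 * card M \<and>
     s\<^sub>1 \<in> M \<rightarrow> B \<times> P \<and> inj_on s\<^sub>1 M \<and> s\<^sub>2 \<in> M \<rightarrow> B \<times> P \<and> inj_on s\<^sub>2 M \<and> s\<^sub>3 \<in> M \<rightarrow> B \<times> P \<and> inj_on s\<^sub>3 M \<and>
     (\<forall>y\<in>M. \<forall>h\<in>G. (F (snd (s\<^sub>1 y)) h \<noteq> (F (snd (s\<^sub>2 y)) h \<noteq> F (snd (s\<^sub>3 y)) h)) \<longleftrightarrow> h = g)"
  proof (intro exI conjI)
    show "B \<times> M \<subseteq> B \<times> P" using M by auto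
    show "card (B \<times> P) \<le> 9 * card (B \<times> M)"
      using mult_le_mono2[OF M(2), of "card B"] by (simp add: card_cartesian_product mult.left_commute)
    show "\<forall>y\<in>B \<times> M. \<forall>h\<in>G. (F (snd (map_prod id s\<^sub>1 y)) h \<noteq> (F (snd (map_prod id s\<^sub>2 y)) h \<noteq> F (snd (map_prod id s\<^sub>3 y)) h)) \<longleftrightarrow> h = g"
      using dec by auto
  qed (use lift s in blast)+
qed

lemma matching_code_exists:
  fixes X :: nat
  assumes X: "X \<ge> 40"
  obtains G :: "nat set set" and P :: "(nat set \<Rightarrow> nat) set" and F
  where "matching_code G P F" "finite G" "finite P" "P \<noteq> {}"
    "card P \<le> 511 ^ (3 * X ^ (4 * X))" "exp ((real X)\<^sup>2 * ln (real X) / 511) \<le> real (card G)"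
proof -
  obtain a where a: "7 ^ a \<le> X" "X < 7 ^ (a + 1)" using ex_power_ivl1[of 7 X] X by auto
  obtain b where b: "73 ^ b \<le> X" "X < 73 ^ (b + 1)" using ex_power_ivl1[of 73 X] X by auto
  define w :: nat where "w = 7 ^ a * 73 ^ b - 1"
  define U where "U = {..<X ^ 4}"
  define G where "G = {g. g \<subseteq> U \<and> card g = w}"
  define H where "H = {T. T \<subseteq> U \<and> card T \<in> {0, 7 ^ a - 1, 73 ^ b - 1}}"
  define P where "P = H \<rightarrow>\<^sub>E {..<511::nat}"
  have U: "finite U" "card U = X ^ 4" by (auto simp: U_def)
  have fin: "finite G" "finite H" using U by (auto simp: G_def H_def)
  have code: "matching_code G P (\<lambda>x g. lfsr (\<Sum>T\<in>{T\<in>H. T \<subseteq> g}. x T))"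
    unfolding G_def P_def H_def w_def by (rule matching_code_subsets[OF U(1)])
  have "w + 1 = 7 ^ a * 73 ^ b" by (simp add: w_def)
  have w_le: "w \<le> X ^ 2"
    using mult_mono[OF a(1) b(1)] by (simp add: w_def power2_eq_square)
  have "X ^ 2 \<le> 7 ^ (a + 1) * 73 ^ (b + 1)"
    unfolding power2_eq_square using a(2) b(2) by (intro mult_mono) auto
  also have "\<dots> = 511 * (w + 1)" unfolding \<open>w + 1 = 7 ^ a * 73 ^ b\<close> by simp
  finally have "real (X ^ 2) \<le> real (511 * (w + 1))" by (rule of_nat_mono)
  moreover have "real X ^ 2 \<ge> 40 ^ 2" using X by (intro power_mono) auto
  ultimately have w_ge: "(real X)\<^sup>2 / 1022 \<le> real w" by (simp add: field_simps)
  then have "w > 0" using X by (cases w) auto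
  have "card H \<le> 3 * X ^ (4 * X)"
  proof -
    have *: "card {T. T \<subseteq> U \<and> card T = D} \<le> X ^ (4 * X)" if "D \<le> X" for D
    proof -
      have "card {T. T \<subseteq> U \<and> card T = D} = (X ^ 4 choose D)" using U by (simp add: n_subsets)
      also have "\<dots> \<le> (X ^ 4) ^ D"
        using binomial_le_pow[of D "X ^ 4"] by (cases "D \<le> X ^ 4") (auto simp: binomial_eq_0)
      also have "\<dots> \<le> X ^ (4 * X)" unfolding power_mult[symmetric] using that X by (intro power_increasing) auto
      finally show ?thesis .
    qed
    have "H = {T. T \<subseteq> U \<and> card T = 0} \<union> ({T. T \<subseteq> U \<and> card T = 7 ^ a - 1} \<union> {T. T \<subseteq> U \<and> card T = 73 ^ b - 1})"
      by (auto simp: H_def)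
    then have "card H \<le> card {T. T \<subseteq> U \<and> card T = 0} +
       (card {T. T \<subseteq> U \<and> card T = 7 ^ a - 1} + card {T. T \<subseteq> U \<and> card T = 73 ^ b - 1})"
      by (metis (no_types, lifting) add_left_mono card_Un_le order_trans)
    also have "\<dots> \<le> X ^ (4 * X) + (X ^ (4 * X) + X ^ (4 * X))"
      using a(1) b(1) by (intro add_mono *) auto
    finally show ?thesis by simp
  qed
  then have card_P: "card P \<le> 511 ^ (3 * X ^ (4 * X))"
    using fin(2) by (simp add: P_def card_PiE power_increasing)
  have "exp ((real X)\<^sup>2 * ln (real X) / 511) \<le> exp (2 * real w * ln (real X))"
  proof -
    have "(real X)\<^sup>2 / 511 * ln (real X) \<le> 2 * real w * ln (real X)"
      using w_ge X by (intro mult_right_mono) (auto simp: field_simps)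
    then show ?thesis by simp
  qed
  also have "\<dots> = (real X ^ 2) ^ w"
  proof -
    have "2 * real w * ln (real X) = real (2 * w) * ln (real X)" by simp
    then have "exp (2 * real w * ln (real X)) = exp (ln (real X)) ^ (2 * w)"
      by (simp only: exp_of_nat_mult)
    also have "\<dots> = (real X ^ 2) ^ w" using X by (simp add: power_mult)
    finally show ?thesis .
  qed
  also have "\<dots> \<le> (real (X ^ 4) / real w) ^ w"
  proof (intro power_mono)
    have "real X ^ 2 * real w \<le> real X ^ 2 * real X ^ 2"
      using w_le by (intro mult_left_mono) (auto simp flip: of_nat_power)
    then show "real X ^ 2 \<le> real (X ^ 4) / real w"
      using \<open>w > 0\<close> by (simp add: field_simps flip: power_add)
  qed simp
  also have "\<dots> \<le> real (X ^ 4 choose w)"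
  proof (rule binomial_ge_n_over_k_pow_k)
    have "X ^ 2 \<le> X ^ 4" using X by (intro power_increasing) auto
    then show "w \<le> X ^ 4" using w_le by linarith
  qed
  also have "\<dots> = real (card G)" using U by (simp add: G_def n_subsets)
  finally have card_G: "exp ((real X)\<^sup>2 * ln (real X) / 511) \<le> real (card G)" .
  have P: "finite P" "P \<noteq> {}" using fin unfolding P_def by (auto intro!: finite_PiE simp: PiE_eq_empty_iff lessThan_empty_iff bot_nat_def)
  show thesis by (rule that[OF code fin(1) P card_P card_G])
qed

definition rate :: "nat \<Rightarrow> real" where
  "rate n = (ln (ln (real n)))\<^sup>2 / ln (ln (ln (real n)))"

lemma rate_le:
  fixes X n :: nat
  assumes X: "X \<ge> 40" and n: "511 ^ (3 * X ^ (4 * X)) \<le> n" "n < 511 ^ (3 * Suc X ^ (4 * Suc X))"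
  shows "rate n \<le> 256 * ((real X)\<^sup>2 * ln (real X))"
proof -
  define y where "y = ln (ln (real n))"
  have n0: "real n > 0" using n by (auto intro: Nat.gr0I)
  have lnX: "ln (real X) \<ge> 1"
  proof -
    have "exp 1 \<le> real X" using e_less_272 X by linarith
    then show ?thesis using X by (subst ln_ge_iff) auto
  qed
  have ln511: "1 \<le> ln (511::real)" "ln (511::real) \<le> 9"
  proof -
    have "exp 1 \<le> (511::real)" using e_less_272 by linarith
    then show "1 \<le> ln (511::real)" by (subst ln_ge_iff) auto
    have "ln (511::real) \<le> ln (2 ^ 9)" by (subst ln_le_cancel_iff) auto
    also have "\<dots> = 9 * ln 2" by (subst ln_realpow) auto
    also have "\<dots> \<le> 9" using ln_le_minus_one[of "2::real"] by simp
    finally show "ln (511::real) \<le> 9" .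
  qed
  have "real X ^ X \<le> real X ^ (4 * X)"
    using X by simp
  also have "\<dots> \<le> (3 * real X ^ (4 * X)) * ln 511"
    using mult_mono[of 1 "3 * ln 511" "real X ^ (4 * X)" "real X ^ (4 * X)"] ln511 by (simp add: mult_ac)
  also have "\<dots> = ln (real (511 ^ (3 * X ^ (4 * X))))" by (simp add: ln_realpow)
  also have "\<dots> \<le> ln (real n)" using n(1) n0 by (subst ln_le_cancel_iff) (auto simp del: of_nat_power)
  finally have ln_ge: "real X ^ X \<le> ln (real n)" by simp
  then have "ln (real X ^ X) \<le> y"
    unfolding y_def using X by (subst ln_le_cancel_iff) (auto intro: less_le_trans[rotated])
  then have "real X * ln (real X) \<le> y" using X by (simp add: ln_realpow)
  moreover have "real X * 1 \<le> real X * ln (real X)" using lnX by (intro mult_left_mono) auto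
  ultimately have yX: "real X \<le> y" by simp
  then have ln_y: "ln (real X) \<le> ln y" using X by (subst ln_le_cancel_iff) auto
  have "ln (real n) \<le> ln (real (511 ^ (3 * Suc X ^ (4 * Suc X))))"
    using n(2) n0 by (subst ln_le_cancel_iff) (auto simp del: of_nat_power)
  also have "\<dots> = (3 * real (Suc X) ^ (4 * Suc X)) * ln 511" by (simp add: ln_realpow del: of_nat_Suc power_Suc mult_Suc_right)
  also have "\<dots> \<le> (3 * real (Suc X) ^ (4 * Suc X)) * 9"
    using ln511 by (intro mult_left_mono) auto
  also have "\<dots> = 27 * real (Suc X) ^ (4 * Suc X)" by simp
  also have "\<dots> \<le> real (Suc X) * real (Suc X) ^ (4 * Suc X)"
    using X by (intro mult_right_mono) auto
  also have "\<dots> = real (Suc X) ^ (4 * X + 5)" by (simp add: power_add algebra_simps numeral_eq_Suc)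
  also have "\<dots> \<le> real (Suc X) ^ (8 * X)" using X by (intro power_increasing) auto
  also have "\<dots> \<le> (real X ^ 2) ^ (8 * X)"
  proof (intro power_mono)
    have "2 * real X \<le> real X * real X" using X by (intro mult_right_mono) auto
    then show "real (Suc X) \<le> real X ^ 2" using X unfolding power2_eq_square of_nat_Suc by linarith
  qed simp
  also have "\<dots> = real X ^ (16 * X)" by (simp flip: power_mult)
  finally have "y \<le> ln (real X ^ (16 * X))"
    unfolding y_def using X ln_ge by (subst ln_le_cancel_iff) (auto intro: less_le_trans[rotated])
  then have y_le: "y \<le> 16 * real X * ln (real X)" using X by (simp add: ln_realpow)
  have "rate n = y\<^sup>2 / ln y" by (simp add: rate_def y_def)
  also have "\<dots> \<le> (16 * real X * ln (real X))\<^sup>2 / ln (real X)"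
    using y_le yX ln_y lnX X by (intro frac_le power_mono) auto
  also have "\<dots> = 256 * ((real X)\<^sup>2 * ln (real X))"
    using lnX by (simp add: power_mult_distrib power2_eq_square)
  finally show ?thesis .
qed

definition has_code :: "nat \<Rightarrow> bool" where
  "has_code n \<longleftrightarrow> (\<exists>(G :: nat set set) (Y :: (nat \<times> (nat set \<Rightarrow> nat)) set) F.
     matching_code G Y F \<and> finite G \<and> finite Y \<and> Y \<noteq> {} \<and> card Y \<le> n \<and> n \<le> 2 * card Y \<and>
     exp (rate n / 130816) \<le> real (card G))"

lemma has_codeE:
  assumes "has_code n"
  obtains G :: "nat set set" and Y :: "(nat \<times> (nat set \<Rightarrow> nat)) set" and F
  where "matching_code G Y F" "finite G" "finite Y" "Y \<noteq> {}" "card Y \<le> n" "n \<le> 2 * card Y"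
     "exp (rate n / 130816) \<le> real (card G)"
  using assms unfolding has_code_def by (elim exE conjE)

lemma has_code_eventually: "\<exists>n\<^sub>0. \<forall>n\<ge>n\<^sub>0. has_code n"
proof (rule exI[of _ "511 ^ (3 * 40 ^ (4 * 40))"], intro allI impI)
  fix n :: nat
  define f :: "nat \<Rightarrow> nat" where "f X = 511 ^ (3 * X ^ (4 * X))" for X
  assume "511 ^ (3 * 40 ^ (4 * 40)) \<le> n"
  then have n: "f 40 \<le> n" by (simp only: f_def)
  have f_ge: "X < f X" if "X \<ge> 1" for X
  proof -
    have "X ^ 1 \<le> X ^ (4 * X)" using that by (intro power_increasing) auto
    then have "X \<le> 3 * X ^ (4 * X)" by simp
    also have "\<dots> < 511 ^ (3 * X ^ (4 * X))" by (rule power_gt_expt) simp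
    finally show ?thesis by (simp add: f_def)
  qed
  have "\<exists>X\<ge>40. f X \<le> n \<and> n < f (Suc X)"
  proof (rule ccontr)
    assume *: "\<not> ?thesis"
    have "f (40 + k) \<le> n" for k
    proof (induction k)
      case (Suc k)
      then have "\<not> n < f (Suc (40 + k))" using * by auto
      then show ?case by simp
    qed (use n in simp)
    from this[of n] f_ge[of "40 + n"] show False by simp
  qed
  then obtain X where X: "X \<ge> 40" "f X \<le> n" "n < f (Suc X)" by blast
  obtain G :: "nat set set" and P :: "(nat set \<Rightarrow> nat) set" and F
    where code: "matching_code G P F" "finite G" "finite P" "P \<noteq> {}"
    "card P \<le> f X" and G: "exp ((real X)\<^sup>2 * ln (real X) / 511) \<le> real (card G)"
    using matching_code_exists[OF X(1)] unfolding f_def by metis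
  define b where "b = n div card P"
  define Y where "Y = {..<b} \<times> P"
  have P: "card P > 0" using code by (simp add: card_gt_0_iff)
  have "card P \<le> n" using code(5) X(2) by linarith
  then have b: "b \<ge> 1" unfolding b_def using P by (simp add: div_greater_zero_iff Suc_le_eq)
  have card_Y: "card Y = b * card P" by (simp add: Y_def card_cartesian_product)
  have "n = b * card P + n mod card P" by (simp add: b_def)
  moreover have "n mod card P < card P" using P by simp
  moreover have "card P \<le> b * card P" using b by simp
  ultimately have "card Y \<le> n" "n \<le> 2 * card Y" unfolding card_Y by linarith+
  moreover have "matching_code G Y (\<lambda>y. F (snd y))"
    unfolding Y_def by (rule matching_code_blocks) fact+
  moreover have "finite Y" "Y \<noteq> {}" using code b unfolding Y_def by (auto simp: lessThan_empty_iff bot_nat_def)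
  moreover have "exp (rate n / 130816) \<le> real (card G)"
  proof -
    have "rate n \<le> 256 * ((real X)\<^sup>2 * ln (real X))" using rate_le[OF X(1)] X(2,3) by (simp only: f_def)
    then have "exp (rate n / 130816) \<le> exp ((real X)\<^sup>2 * ln (real X) / 511)" by simp
    with G show ?thesis by linarith
  qed
  ultimately show "has_code n"
    unfolding has_code_def using code(2) by blast
qed

lemma degree_cutoff_exists:
  fixes n :: nat
  assumes n: "n > 15"
  obtains m :: nat where "m > 0" "n ^ 3 * (2 * (m * (2 * m + 1))) \<le> 2 ^ m"
    "2 * real (m * (2 * m + 1)) + 1 \<le> 2700 * (ln (real n))\<^sup>2"
proof -
  obtain l where l: "2 ^ l \<le> n" "n < 2 ^ (l + 1)" using ex_power_ivl1[of 2 n] n by auto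
  define L where "L = l + 1"
  have "l \<ge> 3"
  proof (rule ccontr)
    assume "\<not> l \<ge> 3"
    then have "l + 1 \<le> 3" by simp
    then have "(2::nat) ^ (l + 1) \<le> 2 ^ 3" by (intro power_increasing) auto
    then show False using l n by simp
  qed
  then have L: "L \<ge> 4" by (simp add: L_def)
  have "ln (real n) \<ge> 1"
  proof -
    have "exp 1 \<le> real n" using e_less_272 n by linarith
    then show ?thesis using n by (subst ln_ge_iff) auto
  qed
  moreover have "real l \<le> 2 * ln (real n)"
  proof -
    have "real l * ln 2 = ln (real (2 ^ l))" by (simp add: ln_realpow)
    also have "\<dots> \<le> ln (real n)" using l n by (subst ln_le_cancel_iff) (auto simp del: of_nat_power)
    finally have "real l * ln 2 \<le> ln (real n)" .
    moreover have "real l * (1 / 2) \<le> real l * ln 2" using ln2_ge_two_thirds by (intro mult_left_mono) auto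
    ultimately show ?thesis by linarith
  qed
  ultimately have L_le: "real L \<le> 3 * ln (real n)" by (simp add: L_def)
  have square: "16 * L * (16 * L + 1) \<le> 272 * L ^ 2"
    using L by (simp add: power2_eq_square algebra_simps)
  show thesis
  proof (rule that[of "8 * L"])
    show "8 * L > 0" using L by simp
    have "n ^ 3 * (2 * (8 * L * (2 * (8 * L) + 1))) = n ^ 3 * (16 * L * (16 * L + 1))" by simp
    also have "\<dots> \<le> (2 ^ L) ^ 3 * (2 ^ 5) ^ L"
    proof (intro mult_mono power_mono)
      show "n \<le> 2 ^ L" using l by (simp add: L_def)
      note square
      also have "272 * L ^ 2 \<le> 2 ^ 12 * (2 ^ L) ^ 2" by (intro mult_mono power_mono) (auto intro: less_imp_le)
      also have "\<dots> = 2 ^ (12 + 2 * L)" by (simp add: power_add mult.commute flip: power_mult)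
      also have "\<dots> \<le> 2 ^ (5 * L)" using L by (intro power_increasing) auto
      finally show "16 * L * (16 * L + 1) \<le> (2 ^ 5) ^ L" unfolding power_mult .
    qed auto
    also have "\<dots> = 2 ^ (8 * L)" by (simp only: mult.commute flip: power_mult power_add) simp
    finally show "n ^ 3 * (2 * (8 * L * (2 * (8 * L) + 1))) \<le> 2 ^ (8 * L)" .
    have "1 \<le> L ^ 2" using L by simp
    then have "2 * (8 * L * (2 * (8 * L) + 1)) + 1 \<le> 300 * L ^ 2" using square by simp
    then have "real (2 * (8 * L * (2 * (8 * L) + 1)) + 1) \<le> real (300 * L ^ 2)" by (rule of_nat_mono)
    also have "\<dots> \<le> 300 * (3 * ln (real n)) ^ 2" using power_mono[OF L_le, of 2] by simp
    finally show "2 * real (8 * L * (2 * (8 * L) + 1)) + 1 \<le> 2700 * (ln (real n))\<^sup>2"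
      by (simp add: power_mult_distrib)
  qed
qed

theorem corollary1p4:
  shows "\<exists>c>0. \<exists>c'>0. \<forall>n::nat. \<forall>q::real. \<forall>K::real. \<forall>nrm.
    n > 15 \<longrightarrow> q \<ge> 2 \<longrightarrow> K \<ge> 1 \<longrightarrow>
    norm_on (tensor_space n) nrm \<longrightarrow> tensor_symmetric n K nrm \<longrightarrow>
    cotype_const (tensor_space n) nrm q \<ge>
      ereal (c' *
        (nrm (\<Sum>i=1..n. tensor3 (stdbasis i) (stdbasis i) (stdbasis i)) /
         nrm (\<Sum>i=1..n. \<Sum>j=1..n. \<Sum>k=1..n.
                tensor3 (stdbasis i) (stdbasis j) (stdbasis k))) *
        (exp (c / q * ((ln (ln (real n)))\<^sup>2 / ln (ln (ln (real n))))) /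
         (K\<^sup>2 * ln (real n))))"
proof -
  define c :: real where "c = 1 / 261632"
  obtain n\<^sub>0 where code_ex: "has_code n" if "n \<ge> n\<^sub>0" for n
    using has_code_eventually by blast
  define R where "R = Max (insert 0 ((\<lambda>n. \<bar>rate n\<bar>) ` {..n\<^sub>0}))"
  have R: "R \<ge> 0" "rate n \<le> R" if "n \<le> n\<^sub>0" for n
  proof -
    show "R \<ge> 0" unfolding R_def by (intro Max_ge) auto
    have "\<bar>rate n\<bar> \<le> R" unfolding R_def using that by (intro Max_ge) auto
    then show "rate n \<le> R" by simp
  qed
  define c' where "c' = min (1 / 48600) (exp (- R))"
  have c': "c' > 0" "c' \<le> 1 / 48600" "c' \<le> exp (- R)" by (auto simp: c'_def)
  have "ereal (c' * (nrm (tensor_of n (\<lambda>i j k. of_bool (i = j \<and> j = k))) / nrm (tensor_of n (\<lambda>i j k. 1))) *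
        (exp (c / q * rate n) / (K\<^sup>2 * ln (real n)))) \<le> cotype_const (tensor_space n) nrm q"
    if n: "n > 15" and q: "q \<ge> 2" and K: "K \<ge> 1"
      and nrm: "norm_on (tensor_space n) nrm" "tensor_symmetric n K nrm" for n q K nrm
  proof -
    interpret symmetric_tensor_seminorm n K "\<lambda>A. nrm (tensor_of n A)"
      by (rule symmetric_tensor_seminorm_tensor_of) fact+
    define D where "D = nrm (tensor_of n (\<lambda>i j k. of_bool (i = j \<and> j = k)))"
    define J where "J = nrm (tensor_of n (\<lambda>i j k. 1))"
    define E where "E = exp (c / q * rate n)"
    have D: "D \<ge> 0" "D \<le> K * J" and J: "J \<ge> 0"
      using N_nonneg N_diagonal_le_box by (simp_all add: D_def J_def box_def)
    have E: "E > 0" by (simp add: E_def)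
    have ln_n: "ln (real n) \<ge> 1"
    proof -
      have "exp 1 \<le> real n" using e_less_272 n by linarith
      then show ?thesis using n by (subst ln_ge_iff) auto
    qed
    have "ereal (c' * (D / J) * (E / (K\<^sup>2 * ln (real n)))) \<le> cotype_const (tensor_space n) nrm q"
    proof (cases "J = 0")
      case True
      then show ?thesis using cotype_const_nonneg by (simp add: zero_ereal_def)
    next
      case False
      then have J: "J > 0" using J by simp
      have DJ: "D / J \<le> K" "D / J \<ge> 0" using D J by (simp_all add: divide_le_eq)
      show ?thesis
      proof (cases "c' * E \<le> K * ln (real n)")
        case True
        have "c' * (D / J) * (E / (K\<^sup>2 * ln (real n))) = (D / J) * (c' * E / (K\<^sup>2 * ln (real n)))" by simp
        also have "\<dots> \<le> K * (K * ln (real n) / (K\<^sup>2 * ln (real n)))"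
        proof (rule mult_mono)
          show "c' * E / (K\<^sup>2 * ln (real n)) \<le> K * ln (real n) / (K\<^sup>2 * ln (real n))"
            by (rule divide_right_mono[OF True]) (use ln_n in simp)
        qed (use DJ K ln_n c' E in auto)
        also have "\<dots> = 1" using K ln_n by (simp add: power2_eq_square)
        finally have "ereal (c' * (D / J) * (E / (K\<^sup>2 * ln (real n)))) \<le> 1" by (simp add: one_ereal_def)
        also have "1 \<le> cotype_const (tensor_space n) nrm q"
          using q J by (intro cotype_const_ge_1[OF nrm(1) tensor_of_mem]) (auto simp: J_def)
        finally show ?thesis .
      next
        case False
        have n_large: "n \<ge> n\<^sub>0"
        proof (rule ccontr)
          assume "\<not> n \<ge> n\<^sub>0"
          then have R: "R \<ge> 0" "rate n \<le> R" using R[of n] by simp_all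
          from R(2) have "c / q * rate n \<le> c / q * R" using q by (intro mult_left_mono) (auto simp: c_def)
          also have "\<dots> \<le> 1 * R" using q R(1) by (intro mult_right_mono) (auto simp: c_def divide_le_eq)
          finally have "E \<le> exp R" by (simp add: E_def)
          then have "c' * E \<le> exp (- R) * exp R" using c' E by (intro mult_mono) auto
          also have "\<dots> \<le> K * ln (real n)" using mult_mono[OF K ln_n] K by (simp flip: exp_add)
          finally show False using False by simp
        qed
        have "K * ln (real n) < c' * E" using False by simp
        also have "\<dots> \<le> 1 * E" using c' E by (intro mult_right_mono) auto
        finally have KE: "K * ln (real n) < E" by simp
        have "1 * ln (real n) \<le> K * ln (real n)" using K ln_n by (intro mult_right_mono) auto
        with KE have ln_E: "ln (real n) \<le> E" by simp
        obtain G :: "nat set set" and Y :: "(nat \<times> (nat set \<Rightarrow> nat)) set" and F where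
          code: "matching_code G Y F" "finite G" "finite Y" "Y \<noteq> {}" "card Y \<le> n" "n \<le> 2 * card Y"
          and G: "exp (rate n / 130816) \<le> real (card G)"
          using code_ex[OF n_large] by (elim has_codeE) (rule that)
        obtain m where m: "m > 0" "n ^ 3 * (2 * (m * (2 * m + 1))) \<le> 2 ^ m"
          and m_le: "2 * real (m * (2 * m + 1)) + 1 \<le> 2700 * (ln (real n))\<^sup>2"
          using degree_cutoff_exists[OF n] by blast
        have "E ^ 2 = exp (rate n / 130816) powr (1 / q)"
          by (simp add: E_def c_def powr_def exp_of_nat_mult[symmetric] flip: exp_add power2_eq_square)
        also have "\<dots> \<le> real (card G) powr (1 / q)"
          using G q by (intro powr_mono2) auto
        finally have E2: "E ^ 2 \<le> real (card G) powr (1 / q)" .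
        have "c' * (D / J) * (E / (K\<^sup>2 * ln (real n))) \<le> (1 / 48600) * (D / J) * (E / (K\<^sup>2 * ln (real n)))"
          using c' DJ E K ln_n by (intro mult_right_mono) auto
        also have "\<dots> = (E * ln (real n)) * (D / (18 * K)) / ((2700 * (ln (real n))\<^sup>2) * (K * J))"
          using K ln_n J by (simp add: field_simps power2_eq_square)
        also have "\<dots> \<le> (E * E) * (D / (18 * K)) / ((2700 * (ln (real n))\<^sup>2) * (K * J))"
          using ln_E E D K J by (intro divide_right_mono mult_right_mono mult_left_mono) auto
        also have "\<dots> \<le> (real (card G) powr (1 / q)) * (D / (18 * K)) / ((2 * real (m * (2 * m + 1)) + 1) * (K * J))"
          using E2 m_le D K J by (intro frac_le mult_mono mult_right_mono) (auto simp: power2_eq_square intro!: mult_pos_pos add_nonneg_pos)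
        finally have "ereal (c' * (D / J) * (E / (K\<^sup>2 * ln (real n)))) \<le>
            ereal ((real (card G) powr (1 / q)) * (D / (18 * K)) / ((2 * real (m * (2 * m + 1)) + 1) * (K * J)))" by simp
        also have "\<dots> \<le> cotype_const (tensor_space n) nrm q"
          unfolding D_def J_def using q by (intro cotype_const_ge_code[OF nrm K code m]) auto
        finally show ?thesis .
      qed
    qed
    then show ?thesis by (simp only: D_def J_def E_def)
  qed
  moreover have "tensor_of n (\<lambda>i j k. 1) = (\<Sum>i=1..n. \<Sum>j=1..n. \<Sum>k=1..n. tensor3 (stdbasis i) (stdbasis j) (stdbasis k))" for n
    by (simp add: tensor_of_def)
  ultimately show ?thesis
    using c'(1) unfolding tensor_of_diagonal rate_def
    by (intro exI[of _ c] exI[of _ c'] conjI) (auto simp: c_def)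
qed

end
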